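(* Let $\lambda,\mu,\theta\in(0,\infty)$ with $\lambda\ge\mu$, let $\gamma_0=\lambda-\mu$, and let $\bar R^n(t)$ be the rescaled reneging count by time $t$ in the $n$-th M/M/1+M system defined in the context (with $x_n\to x_0\in\mathbb{R}_+$). For $\gamma>\gamma_0$ let $$\chi^{+}(\gamma)=\limsup_{t\to\infty}\limsup_{n\to\infty}\frac1t\frac1n\log P(\bar R^n(t)\ge\gamma t),\qquad \chi^{-}(\gamma)=\liminf_{t\to\infty}\liminf_{n\to\infty}\frac1t\frac1n\log P(\bar R^n(t)>\gamma t),$$ and for $\gamma\in(0,\gamma_0)$ (if $\gamma_0>0$) let $$\chi^{+}(\gamma)=\limsup_{t\to\infty}\limsup_{n\to\infty}\frac1t\frac1n\log P(\bar R^n(t)\le\gamma t),\qquad \chi^{-}(\gamma)=\liminf_{t\to\infty}\liminf_{n\to\infty}\frac1t\frac1n\log P(\bar R^n(t)<\gamma t).$$ Then for every $\gamma>0$ with $\gamma\ne\gamma_0$, $$\chi^+(\gamma)=\chi^-(\gamma)=-C(\gamma),$$ where $$C(\gamma)=\lambda(1-z_\gamma^{-1})+\mu(1-z_\gamma)-\gamma\log z_\gamma,\qquad z_\gamma=\frac{\sqrt{\gamma^2+4\lambda\mu}-\gamma}{2\mu}.$$ In particular these quantities do not depend on $\theta$.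
   Context: For each $n$ let $N_1^n,N_2^n,N_3^n$ be mutually independent Poisson random measures on $[0,\infty)$, $[0,\infty)$, $[0,\infty)\times\mathbb{R}_+$ with intensities $n\lambda\,ds$, $n\mu\,ds$, $n\theta\,ds\,dy$ respectively. Let $x_n\ge 0$ with $nx_n\in\mathbb{Z}_+$, and $x_n\to x_0\in\mathbb{R}_+$. The processes $X^n$ (rescaled number in system) and $\bar R^n$ (rescaled cumulative reneging count) are given by $$X^{n}(t)=x_{n}+\frac1n\int_{[0,t]}N_{1}^{n}(ds)-\frac1n\int_{[0,t]}\mathbf{1}_{\{X^{n}(s-)\neq 0\}}N_{2}^{n}(ds)-\bar R^n(t),$$ $$\bar R^{n}(t)=\frac1n\int_{[0,t]\times\mathbb{R}_+}\mathbf{1}_{[0,(X^{n}(s-)-\frac1n)^{+}]}(y)\,N_{3}^{n}(ds\,dy),\quad t\ge0.$$ That is, $nX^n$ is the number of customers in a single server queue with Poisson arrivals of rate $\lambda n$, exponential service of rate $\mu n$ and exponential patience of rate $\theta$ for each customer waiting in the queue. *)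

theory Defs
  imports "HOL-Probability.Probability"
begin

definition random_measure :: "'w measure \<Rightarrow> 'e measure \<Rightarrow> ('w \<Rightarrow> 'e measure) \<Rightarrow> bool" where
  "random_measure M E N \<longleftrightarrow>
     (\<forall>\<omega>\<in>space M. sets (N \<omega>) = sets E) \<and>
     (\<forall>A\<in>sets E. (\<lambda>\<omega>. emeasure (N \<omega>) A) \<in> borel_measurable M)"

(* The Poisson weights are written out because the library's poisson_pmf excludes rate 0,
   which occurs here for sets of intensity 0. *)
definition poisson_random_measure :: "'w measure \<Rightarrow> 'e measure \<Rightarrow> ('w \<Rightarrow> 'e measure) \<Rightarrow> bool" where
  "poisson_random_measure M \<nu> N \<longleftrightarrow>
     random_measure M \<nu> N \<and>
     (\<forall>A\<in>sets \<nu>. emeasure \<nu> A < \<infinity> \<longrightarrow>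
        (\<forall>k::nat. measure M {\<omega>\<in>space M. emeasure (N \<omega>) A = of_nat k}
                  = measure \<nu> A ^ k / fact k * exp (- measure \<nu> A))) \<and>
     (\<forall>A\<in>sets \<nu>. emeasure \<nu> A = \<infinity> \<longrightarrow> (AE \<omega> in M. emeasure (N \<omega>) A = \<infinity>)) \<and>
     (\<forall>(A :: nat \<Rightarrow> 'e set) k. (\<forall>i<k. A i \<in> sets \<nu>) \<and> disjoint_family_on A {..<k} \<longrightarrow>
        prob_space.indep_vars M (\<lambda>_. borel) (\<lambda>i \<omega>. emeasure (N \<omega>) (A i)) {..<k})"

definition random_measure_events :: "'w measure \<Rightarrow> 'e measure \<Rightarrow> ('w \<Rightarrow> 'e measure) \<Rightarrow> 'w set set" where
  "random_measure_events M E N =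
     sigma_sets (space M)
       {(\<lambda>\<omega>. emeasure (N \<omega>) A) -` B \<inter> space M | A B. A \<in> sets E \<and> B \<in> sets borel}"

definition cadlag :: "(real \<Rightarrow> real) \<Rightarrow> bool" where
  "cadlag f \<longleftrightarrow>
     (\<forall>t\<ge>0. (f \<longlongrightarrow> f t) (at_right t)) \<and> (\<forall>t>0. \<exists>l. (f \<longlongrightarrow> l) (at_left t))"

(* At s = 0 this depends on irrelevant values of f on the negative half-line; the Poisson
   random measures below almost surely put no mass on time 0. *)
definition left_lim :: "(real \<Rightarrow> real) \<Rightarrow> real \<Rightarrow> real" where
  "left_lim f s = Lim (at_left s) f"

definition time_intensity :: "real \<Rightarrow> real measure" where
  "time_intensity r = scale_measure (ennreal r) (restrict_space lborel {0..})"

definition time_mark_intensity :: "real \<Rightarrow> (real \<times> real) measure" where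
  "time_mark_intensity r = scale_measure (ennreal r) (restrict_space lborel ({0..} \<times> {0..}))"

locale mm1m_system = prob_space P
  for P :: "'w measure" +
  fixes lam mu theta :: real
    and n :: nat
    and x :: real
    and N1 N2 :: "'w \<Rightarrow> real measure"
    and N3 :: "'w \<Rightarrow> (real \<times> real) measure"
    and X R :: "real \<Rightarrow> 'w \<Rightarrow> real"
  assumes PRM1: "poisson_random_measure P (time_intensity (real n * lam)) N1"
    and PRM2: "poisson_random_measure P (time_intensity (real n * mu)) N2"
    and PRM3: "poisson_random_measure P (time_mark_intensity (real n * theta)) N3"
    and indep_PRMs:
      "indep_sets (\<lambda>i. [random_measure_events P (time_intensity (real n * lam)) N1,
                        random_measure_events P (time_intensity (real n * mu)) N2,
                        random_measure_events P (time_mark_intensity (real n * theta)) N3] ! i)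
         {..<3}"
    and x_nonneg: "0 \<le> x"
    and x_lattice: "real n * x \<in> \<nat>"
    and X_measurable: "\<And>t. 0 \<le> t \<Longrightarrow> X t \<in> borel_measurable P"
    and R_measurable: "\<And>t. 0 \<le> t \<Longrightarrow> R t \<in> borel_measurable P"
    and X_cadlag: "AE \<omega> in P. cadlag (\<lambda>t. X t \<omega>)"
    and X_eq: "AE \<omega> in P. \<forall>t\<ge>0.
      X t \<omega> = x + 1 / real n * (LINT s:{0..t}|N1 \<omega>. 1)
        - 1 / real n * (LINT s:{0..t}|N2 \<omega>. of_bool (left_lim (\<lambda>u. X u \<omega>) s \<noteq> 0))
        - R t \<omega>"
    and R_eq: "AE \<omega> in P. \<forall>t\<ge>0.
      R t \<omega> = 1 / real n *
        (LINT p:{0..t} \<times> {0..}|N3 \<omega>.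
           indicator {0..max 0 (left_lim (\<lambda>u. X u \<omega>) (fst p) - 1 / real n)} (snd p))"

(* The logarithm on [0, \<infinity>) with log 0 = - \<infinity>; in HOL, ln 0 = 0. *)
definition elog :: "real \<Rightarrow> ereal" where
  "elog p = (if p = 0 then - \<infinity> else ereal (ln p))"

definition chi_plus ::
  "real \<Rightarrow> (nat \<Rightarrow> 'w measure) \<Rightarrow> (nat \<Rightarrow> real \<Rightarrow> 'w \<Rightarrow> real) \<Rightarrow> real \<Rightarrow> ereal" where
  "chi_plus \<gamma>0 P R \<gamma> =
     (if \<gamma> > \<gamma>0
      then Limsup at_top (\<lambda>t::real. limsup (\<lambda>n.
             ereal (1 / t) * ereal (1 / real n) *
             elog (measure (P n) {\<omega>\<in>space (P n). R n t \<omega> \<ge> \<gamma> * t})))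
      else Limsup at_top (\<lambda>t::real. limsup (\<lambda>n.
             ereal (1 / t) * ereal (1 / real n) *
             elog (measure (P n) {\<omega>\<in>space (P n). R n t \<omega> \<le> \<gamma> * t}))))"

definition chi_minus ::
  "real \<Rightarrow> (nat \<Rightarrow> 'w measure) \<Rightarrow> (nat \<Rightarrow> real \<Rightarrow> 'w \<Rightarrow> real) \<Rightarrow> real \<Rightarrow> ereal" where
  "chi_minus \<gamma>0 P R \<gamma> =
     (if \<gamma> > \<gamma>0
      then Liminf at_top (\<lambda>t::real. liminf (\<lambda>n.
             ereal (1 / t) * ereal (1 / real n) *
             elog (measure (P n) {\<omega>\<in>space (P n). R n t \<omega> > \<gamma> * t})))
      else Liminf at_top (\<lambda>t::real. liminf (\<lambda>n.
             ereal (1 / t) * ereal (1 / real n) *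
             elog (measure (P n) {\<omega>\<in>space (P n). R n t \<omega> < \<gamma> * t}))))"

definition z_root :: "real \<Rightarrow> real \<Rightarrow> real \<Rightarrow> real" where
  "z_root lam mu \<gamma> = (sqrt (\<gamma>\<^sup>2 + 4 * lam * mu) - \<gamma>) / (2 * mu)"

definition decay_rate :: "real \<Rightarrow> real \<Rightarrow> real \<Rightarrow> real" where
  "decay_rate lam mu \<gamma> =
     lam * (1 - inverse (z_root lam mu \<gamma>)) + mu * (1 - z_root lam mu \<gamma>)
       - \<gamma> * ln (z_root lam mu \<gamma>)"

end

theory Submission
  imports Defs "HOL-Real_Asymp.Real_Asymp"
begin

text \<open>
  Since \<open>n\<close> tends to infinity before \<open>t\<close>, it suffices to control the counts of the Poisson random
  measures on finitely many cells of a fixed time grid.  Write \<open>a\<^sub>i\<close>, \<open>b\<^sub>i\<close> for the rescaled numbers of arrivals and potential services in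
  the \<open>i\<close>-th cell.  Outside an event of arbitrarily small exponential order,
  \<open>R t \<le> x + (\<Sum>i. max 0 (a\<^sub>i - b\<^sub>i)) + \<epsilon> t\<close>: the potential \<open>R + G (X)\<close>, where \<open>G\<close> is a smoothed positive
  part of slope \<open>0\<close> at the origin, gains at most \<open>max 0 (a\<^sub>i - b\<^sub>i)\<close> per cell up to second-order terms,
  because idling only happens where \<open>G\<close> is flat and \<open>R\<close> grows slowly there.  Conversely
  \<open>R t + X t \<ge> x + (N1 - N2) (0, t] / n\<close>, and \<open>X t \<ge> \<epsilon> t\<close> together with \<open>R t \<le> \<gamma> t\<close> is negligible,
  since a long queue reneges at a rate that grows with \<open>t\<close>.  So \<open>R t\<close> has the large deviations of
  the Skellam variable \<open>(N1 - N2) (0, t] / n\<close>, whose rate is the Legendre transform \<open>decay_rate\<close>: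
  Chernoff's bound gives the upper estimates, and Stirling's bound on Poisson weights, applied in
  every cell, the lower ones.
\<close>

section \<open>Path estimates\<close>

text \<open>The sum of positive parts exceeds the netput, yet for \<gamma> > \<gamma>0 it has the
  same rate. It is the largest netput over unions of cells; for fixed \<open>t\<close> there are
  finitely many unions, a factor that disappears as \<open>n\<close> grows, and a union shorter than
  \<open>t\<close> has no larger exponential moment, because \<open>log_mgf\<close> is nonnegative
  at nonnegative tilts when \<open>mu \<le> lam\<close>.

  The quantity \<open>R + X\<close> is no upper potential by itself, since it also grows by the
  services lost while the server idles. Rounding off the positive part trades this loss for two
  errors: a quadratic one with factor \<open>1 / \<kappa>\<close>, and the reneging at queue lengths
  of order \<kappa>, which the drop of the queue no longer offsets. The second is small with
  \<kappa>; the first vanishes when the cells shrink at fixed \<kappa>. This dictates the order in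
  which the constants are chosen: \<kappa>, then the cell bound \<delta>, then the mesh.

  The exceptional events need a prescribed rate \<open>K\<close>, not just small probability. Large
  Chernoff tilts provide it, because the Poisson means involved can be made as small as
  desired.\<close>

definition soft_pos :: "real \<Rightarrow> real \<Rightarrow> real" where
  "soft_pos \<kappa> x = (if x \<le> 0 then 0 else if x \<le> \<kappa> then x\<^sup>2 / (2 * \<kappa>) else x - \<kappa> / 2)"

text \<open>The derivative of \<open>soft_pos \<kappa>\<close>. It is 1 above \<kappa>, where
  reneging is exactly offset by the drop of the queue, and 0 at the origin, where services are
  lost.\<close>

definition soft_pos_slope :: "real \<Rightarrow> real \<Rightarrow> real" where
  "soft_pos_slope \<kappa> x = min 1 (max 0 (x / \<kappa>))"

lemma soft_pos_nonneg: "0 < \<kappa> \<Longrightarrow> 0 \<le> soft_pos \<kappa> x"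
  by (auto simp: soft_pos_def)

lemma soft_pos_le:
  assumes "0 < \<kappa>" "0 \<le> x"
  shows "soft_pos \<kappa> x \<le> x"
  using assms mult_mono[of x \<kappa> x x] by (auto simp: soft_pos_def field_simps power2_eq_square)

text \<open>The minimum over \<open>w\<close> of the right-hand side is the left-hand side; only
  this inequality is needed, and each case rests on the sign of a square. Leaving \<open>w\<close>
  free allows it to be chosen from a point other than \<open>y\<close>.\<close>

lemma soft_pos_le_moreau:
  assumes "0 < \<kappa>"
  shows "soft_pos \<kappa> y \<le> max 0 w + (y - w)\<^sup>2 / (2 * \<kappa>)"
proof -
  have "2 * \<kappa> * soft_pos \<kappa> y \<le> 2 * \<kappa> * max 0 w + (y - w)\<^sup>2"
  proof -
    consider "y \<le> 0" | "0 < y" "y \<le> \<kappa>" "w \<le> 0" | "0 < y" "y \<le> \<kappa>" "0 < w" | "\<kappa> < y" "w \<le> 0" | "\<kappa> < y" "0 < w"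
      by linarith
    then show ?thesis
    proof cases
      case 1
      then show ?thesis using assms by (simp add: soft_pos_def)
    next
      case 2
      then have "y\<^sup>2 \<le> (y - w)\<^sup>2" by (intro power_mono) auto
      then show ?thesis using 2 assms by (simp add: soft_pos_def)
    next
      case 3
      then have "y * w \<le> \<kappa> * w" by (intro mult_right_mono) auto
      then have "0 \<le> 2 * (\<kappa> * w) + w\<^sup>2 - 2 * (y * w)" using zero_le_power2[of w] by linarith
      then show ?thesis using 3 assms by (simp add: soft_pos_def power2_diff algebra_simps)
    next
      case 4
      then have "y\<^sup>2 \<le> (y - w)\<^sup>2" using assms by (intro power_mono) auto
      moreover have "0 \<le> (y - \<kappa>)\<^sup>2" by simp
      ultimately show ?thesis using 4 assms
        by (simp add: soft_pos_def power2_diff algebra_simps) (simp add: power2_eq_square)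
    next
      case 5
      have "0 \<le> (y - w - \<kappa>)\<^sup>2" by simp
      then show ?thesis using 5 assms
        by (simp add: soft_pos_def power2_eq_square algebra_simps)
    qed
  qed
  then show ?thesis using assms by (simp add: field_simps)
qed

text \<open>\<^const>\<open>soft_pos\<close> is the Moreau envelope of the positive part, which gives
  its second-order upper bound.\<close>

lemma soft_pos_step:
  assumes "0 < \<kappa>"
  shows "soft_pos \<kappa> y \<le> soft_pos \<kappa> x + soft_pos_slope \<kappa> x * (y - x) + (y - x)\<^sup>2 / (2 * \<kappa>)"
proof -
  define p where "p = soft_pos_slope \<kappa> x"
  \<comment> \<open>\<open>x - \<kappa> * p\<close> is the proximal point of \<open>x\<close>, the
    \<open>w\<close> that gives equality in the envelope bound at \<open>x\<close>. Keeping this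
    \<open>w\<close> for \<open>y\<close> and expanding the square yields the claim.\<close>
  have "soft_pos \<kappa> x = max 0 (x - \<kappa> * p) + (\<kappa> * p)\<^sup>2 / (2 * \<kappa>)"
    using assms by (auto simp: soft_pos_def p_def soft_pos_slope_def min_def max_def field_simps power2_eq_square)
  moreover have "soft_pos \<kappa> y \<le> max 0 (x - \<kappa> * p) + (y - x + \<kappa> * p)\<^sup>2 / (2 * \<kappa>)"
    using soft_pos_le_moreau[OF assms, of y "x - \<kappa> * p"] by (simp add: algebra_simps)
  moreover have "(y - x + \<kappa> * p)\<^sup>2 / (2 * \<kappa>) = (\<kappa> * p)\<^sup>2 / (2 * \<kappa>) + p * (y - x) + (y - x)\<^sup>2 / (2 * \<kappa>)"
    using assms by (simp add: field_simps power2_eq_square)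
  ultimately show ?thesis by (simp add: p_def)
qed

definition grid :: "real \<Rightarrow> nat \<Rightarrow> nat \<Rightarrow> real" where
  "grid t m i = t * real i / real m"

lemma grid_0 [simp]: "grid t m 0 = 0"
  by (simp add: grid_def)

lemma grid_last [simp]: "0 < m \<Longrightarrow> grid t m m = t"
  by (simp add: grid_def)

lemma grid_mono: "0 \<le> t \<Longrightarrow> i \<le> j \<Longrightarrow> grid t m i \<le> grid t m j"
  by (auto simp: grid_def intro!: divide_right_mono mult_left_mono)

lemma grid_nonneg [simp]: "0 \<le> t \<Longrightarrow> 0 \<le> grid t m i"
  by (simp add: grid_def)

lemma grid_Suc: "grid t m (Suc i) = grid t m i + t / real m"
  by (simp add: grid_def add_divide_distrib distrib_left)

text \<open>One sample path, with the almost sure properties assumed outright, so that the estimates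
  become deterministic. Time 0 carries no mass, because \<open>left_lim X 0\<close> depends on
  values of \<open>X\<close> at negative times. Finiteness of \<open>G\<close> is asked of bounded
  boxes only: a time strip with unbounded marks has infinite intensity.\<close>

locale queue_path =
  fixes n :: nat and x :: real and A S :: "real measure" and G :: "(real \<times> real) measure"
    and X R :: "real \<Rightarrow> real"
  assumes n_pos: "0 < n"
    and sets_A: "sets A = sets (restrict_space lborel ({0..} :: real set))"
    and sets_S: "sets S = sets (restrict_space lborel ({0..} :: real set))"
    and sets_G: "sets G = sets (restrict_space lborel ({0..} \<times> {0..} :: (real \<times> real) set))"
    and finite_A: "\<And>t. emeasure A {0..t} < \<infinity>"
    and finite_S: "\<And>t. emeasure S {0..t} < \<infinity>"
    and finite_G: "\<And>t c. emeasure G ({0..t} \<times> {0..c}) < \<infinity>"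
    and null_A: "emeasure A {0} = 0"
    and null_S: "emeasure S {0} = 0"
    and null_G: "emeasure G ({0} \<times> {0..}) = 0"
    and cadlag_X: "cadlag X"
    and X_eq: "\<And>t. 0 \<le> t \<Longrightarrow> X t = x + 1 / real n * (LINT s:{0..t}|A. 1)
        - 1 / real n * (LINT s:{0..t}|S. of_bool (left_lim X s \<noteq> 0)) - R t"
    and R_eq: "\<And>t. 0 \<le> t \<Longrightarrow> R t = 1 / real n *
        (LINT p:{0..t} \<times> {0..}|G. indicator {0..max 0 (left_lim X (fst p) - 1 / real n)} (snd p))"
begin

section \<open>Left limits of a path\<close>

lemma left_lim_tendsto:
  assumes "0 < t"
  shows "(X \<longlongrightarrow> left_lim X t) (at_left t)"
proof -
  obtain l where l: "(X \<longlongrightarrow> l) (at_left t)"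
    using cadlag_X assms unfolding cadlag_def by auto
  then have "left_lim X t = l"
    unfolding left_lim_def by (intro tendsto_Lim) auto
  with l show ?thesis by simp
qed

lemma left_lim_le:
  assumes "0 \<le> s" "s < t" "\<And>u. s \<le> u \<Longrightarrow> u < t \<Longrightarrow> X u \<le> c"
  shows "left_lim X t \<le> c"
proof (rule tendsto_upperbound[OF left_lim_tendsto])
  show "\<forall>\<^sub>F u in at_left t. X u \<le> c"
    using assms by (auto simp: eventually_at_left intro!: exI[of _ s])
qed (use assms in auto)

lemma left_lim_ge:
  assumes "0 \<le> s" "s < t" "\<And>u. s \<le> u \<Longrightarrow> u < t \<Longrightarrow> c \<le> X u"
  shows "c \<le> left_lim X t"
proof (rule tendsto_lowerbound[OF left_lim_tendsto])
  show "\<forall>\<^sub>F u in at_left t. c \<le> X u"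
    using assms by (auto simp: eventually_at_left intro!: exI[of _ s])
qed (use assms in auto)

text \<open>\<open>X\<close> is evaluated at the largest multiple of \<open>1 / Suc k\<close>
  strictly below \<open>t\<close>. This depends on \<open>t\<close> only through an integer, hence
  is measurable whatever \<open>X\<close> is, and strictness makes the limit the left limit instead
  of \<open>X t\<close>.\<close>

lemma measurable_left_lim: "(\<lambda>t. if 0 < t then left_lim X t else 0) \<in> borel_measurable borel"
proof (rule borel_measurable_LIMSEQ_real)
  show "(\<lambda>t. if 0 < t then X ((of_int \<lceil>real (Suc k) * t\<rceil> - 1) / real (Suc k)) else 0) \<in> borel_measurable borel" for k
  proof -
    have "(\<lambda>t::real. (\<lambda>i::int. X ((of_int i - 1) / real (Suc k))) \<lceil>real (Suc k) * t\<rceil>) \<in> borel_measurable borel"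
      by (rule measurable_compose[where N="count_space UNIV"]) auto
    then show ?thesis by (intro measurable_If) auto
  qed
next
  fix t :: real
  show "(\<lambda>k. if 0 < t then X ((of_int \<lceil>real (Suc k) * t\<rceil> - 1) / real (Suc k)) else 0)
      \<longlonglongrightarrow> (if 0 < t then left_lim X t else 0)"
  proof (cases "0 < t")
    case True
    let ?u = "\<lambda>k. (of_int \<lceil>real (Suc k) * t\<rceil> - 1) / real (Suc k)"
    have lt: "?u k < t" for k
    proof -
      have "of_int \<lceil>real (Suc k) * t\<rceil> - 1 < real (Suc k) * t" by linarith
      then show ?thesis by (simp add: pos_divide_less_eq mult.commute)
    qed
    have ge: "t - 1 / real (Suc k) \<le> ?u k" for k
    proof -
      have "real (Suc k) * t - 1 \<le> of_int \<lceil>real (Suc k) * t\<rceil> - 1" by linarith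
      then have "(real (Suc k) * t - 1) / real (Suc k) \<le> ?u k" by (intro divide_right_mono) auto
      then show ?thesis by (simp add: diff_divide_distrib)
    qed
    have "?u \<longlonglongrightarrow> t"
    proof (rule tendsto_sandwich)
      show "(\<lambda>k. t - 1 / real (Suc k)) \<longlonglongrightarrow> t"
        using tendsto_diff[OF tendsto_const[of t] LIMSEQ_inverse_real_of_nat] by (simp add: inverse_eq_divide)
    qed (use ge lt in \<open>auto intro!: eventuallyI less_imp_le\<close>)
    then have "filterlim ?u (at_left t) sequentially"
      unfolding filterlim_at using lt by (auto intro!: eventuallyI less_imp_neq)
    from filterlim_compose[OF left_lim_tendsto[OF True] this] True show ?thesis by simp
  qed simp
qed

section \<open>Counts on time intervals and their additivity\<close>

lemma sets_A_I: "B \<in> sets borel \<Longrightarrow> B \<subseteq> {0..} \<Longrightarrow> B \<in> sets A"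
  unfolding sets_A by (subst sets_restrict_space_iff) auto

lemma sets_S_I: "B \<in> sets borel \<Longrightarrow> B \<subseteq> {0..} \<Longrightarrow> B \<in> sets S"
  unfolding sets_S by (subst sets_restrict_space_iff) auto

lemma sets_G_I: "B \<in> sets borel \<Longrightarrow> B \<subseteq> {0..} \<times> {0..} \<Longrightarrow> B \<in> sets G"
  unfolding sets_G by (subst sets_restrict_space_iff) (auto simp: borel_Times)

lemma finite_A_subset: "B \<subseteq> {0..t} \<Longrightarrow> emeasure A B \<noteq> \<infinity>"
  using emeasure_mono[of B "{0..t}" A] finite_A[of t] sets_A_I[of "{0..t}"] by (auto simp: top_unique)

lemma finite_S_subset: "B \<subseteq> {0..t} \<Longrightarrow> emeasure S B \<noteq> \<infinity>"
  using emeasure_mono[of B "{0..t}" S] finite_S[of t] sets_S_I[of "{0..t}"] by (auto simp: top_unique)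

lemma finite_G_subset: "B \<subseteq> {0..t} \<times> {0..c} \<Longrightarrow> emeasure G B \<noteq> \<infinity>"
  using emeasure_mono[of B "{0..t} \<times> {0..c}" G] finite_G[of t c]
    sets_G_I[of "{0..t} \<times> {0..c}"] by (force simp: top_unique borel_Times)

lemma fmeasurable_S: "B \<in> sets borel \<Longrightarrow> B \<subseteq> {0..t} \<Longrightarrow> B \<in> fmeasurable S"
  using finite_S_subset[of B t] sets_S_I[of B] by (force simp: fmeasurable_def less_top[symmetric])

lemma fmeasurable_G: "B \<in> sets borel \<Longrightarrow> B \<subseteq> {0..t} \<times> {0..c} \<Longrightarrow> B \<in> fmeasurable G"
  using finite_G_subset[of B t c] sets_G_I[of B] by (force simp: fmeasurable_def less_top[symmetric])

text \<open>Intervals open on the left make consecutive cells disjoint and leave out time 0.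
  Division by \<open>n\<close> puts the counts on the scale of \<open>X\<close> and
  \<open>R\<close>.\<close>

definition a :: "real \<Rightarrow> real \<Rightarrow> real" where "a s t = measure A {s<..t} / real n"
definition b :: "real \<Rightarrow> real \<Rightarrow> real" where "b s t = measure S {s<..t} / real n"
definition g :: "real \<Rightarrow> real \<Rightarrow> real \<Rightarrow> real" where
  "g s t c = measure G ({s<..t} \<times> {0..c}) / real n"

lemma a_nonneg: "0 \<le> a s t" and b_nonneg: "0 \<le> b s t" and g_nonneg: "0 \<le> g s t c"
  by (simp_all add: a_def b_def g_def)

lemma a_add:
  assumes "0 \<le> r" "r \<le> s" "s \<le> t"
  shows "a r t = a r s + a s t"
proof -
  have "measure A ({r<..s} \<union> {s<..t}) = measure A {r<..s} + measure A {s<..t}"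
    using assms by (intro measure_Union sets_A_I finite_A_subset[of _ t]) auto
  then show ?thesis
    using assms by (simp add: a_def ivl_disj_un_two add_divide_distrib)
qed

lemma b_add:
  assumes "0 \<le> r" "r \<le> s" "s \<le> t"
  shows "b r t = b r s + b s t"
proof -
  have "measure S ({r<..s} \<union> {s<..t}) = measure S {r<..s} + measure S {s<..t}"
    using assms by (intro measure_Union sets_S_I finite_S_subset[of _ t]) auto
  then show ?thesis
    using assms by (simp add: b_def ivl_disj_un_two add_divide_distrib)
qed

lemma g_add:
  assumes "0 \<le> r" "r \<le> s" "s \<le> t"
  shows "g r t c = g r s c + g s t c"
proof -
  have "measure G ({r<..s} \<times> {0..c} \<union> {s<..t} \<times> {0..c}) =
      measure G ({r<..s} \<times> {0..c}) + measure G ({s<..t} \<times> {0..c})"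
    using assms
    by (intro measure_Union sets_G_I finite_G_subset[of _ t c]) (auto simp: borel_Times)
  then show ?thesis
    using assms by (simp add: g_def ivl_disj_un_two add_divide_distrib flip: Sigma_Un_distrib1)
qed

text \<open>The supports of the two indicators in the queue equations. Cutting off time 0 makes both
  sets Borel through the measurability of the left limit at positive times.\<close>

definition busy :: "real set" where "busy = {u. 0 < u \<and> left_lim X u \<noteq> 0}"
definition reneging :: "(real \<times> real) set" where
  "reneging = {p. 0 < fst p \<and> 0 \<le> snd p \<and> snd p \<le> max 0 (left_lim X (fst p) - 1 / real n)}"

lemma busy_borel: "busy \<in> sets borel"
proof -
  have "busy = {u. (if 0 < u then left_lim X u else 0) \<noteq> 0}" by (auto simp: busy_def)
  also have "\<dots> \<in> sets borel" using measurable_left_lim by measurable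
  finally show ?thesis .
qed

lemma reneging_borel: "reneging \<in> sets borel"
proof -
  have [measurable]: "(\<lambda>p::real \<times> real. if 0 < fst p then left_lim X (fst p) else 0) \<in> borel_measurable borel"
    by (rule measurable_compose[OF _ measurable_left_lim]) (simp flip: borel_prod)
  have [measurable]: "fst \<in> borel_measurable (borel :: (real \<times> real) measure)"
     "snd \<in> borel_measurable (borel :: (real \<times> real) measure)"
    by (simp_all flip: borel_prod)
  have "reneging = {p. 0 < fst p \<and> 0 \<le> snd p \<and>
     snd p \<le> max 0 ((if 0 < fst p then left_lim X (fst p) else 0) - 1 / real n)}"
    by (auto simp: reneging_def)
  also have "\<dots> \<in> sets borel" by measurable
  finally show ?thesis .
qed

section \<open>The queue equations rewritten as counts\<close>

lemma arrivals_eq: "0 \<le> t \<Longrightarrow> (LINT s:{0..t}|A. 1) = measure A {0<..t}"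
proof -
  assume t: "0 \<le> t"
  have "(LINT s:{0..t}|A. 1) = measure A {0..t}"
    unfolding set_lebesgue_integral_def
    using finite_A[of t] sets_A_I[of "{0..t}"] by (simp add: less_top)
  also have "\<dots> = measure A ({0} \<union> {0<..t})" using t by (auto intro!: arg_cong[where f="measure A"])
  also have "\<dots> = measure A {0} + measure A {0<..t}"
    using t by (intro measure_Union sets_A_I finite_A_subset[of _ t]) auto
  finally show ?thesis using null_A by (simp add: measure_def)
qed

lemma served_eq:
  assumes t: "0 \<le> t"
  shows "(LINT s:{0..t}|S. of_bool (left_lim X s \<noteq> 0)) = measure S (busy \<inter> {0<..t})"
proof -
  let ?f = "\<lambda>s. indicator {0..t} s *\<^sub>R (of_bool (left_lim X s \<noteq> 0) :: real)"
  have ms: "busy \<inter> {0<..t} \<in> sets S" using busy_borel by (intro sets_S_I) auto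
  \<comment> \<open>The integrand at time 0 has an uncontrolled value. This set is empty or
    \<open>{0}\<close>; it is measurable in both cases and null.\<close>
  have "{s\<in>{0}. left_lim X 0 \<noteq> 0} \<in> sets S" by (intro sets_S_I) auto
  then have ms': "busy \<inter> {0<..t} \<union> {s\<in>{0}. left_lim X 0 \<noteq> 0} \<in> sets S" using ms by auto
  have f_eq: "?f = indicator (busy \<inter> {0<..t} \<union> {s\<in>{0}. left_lim X 0 \<noteq> 0})"
    using t by (auto simp: busy_def indicator_def fun_eq_iff)
  have "AE s in S. s \<noteq> 0"
    using null_S sets_S_I[of "{0}"] by (intro AE_I[of _ _ "{0}"]) auto
  then have "AE s in S. ?f s = indicator (busy \<inter> {0<..t}) s"
    by eventually_elim (auto simp: busy_def indicator_def)
  moreover have "?f \<in> borel_measurable S"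
    unfolding f_eq using ms' by (rule borel_measurable_indicator)
  ultimately have "(LINT s:{0..t}|S. of_bool (left_lim X s \<noteq> 0)) = (LINT s|S. indicator (busy \<inter> {0<..t}) s :: real)"
    unfolding set_lebesgue_integral_def using ms
    by (intro integral_cong_AE borel_measurable_indicator)
  then show ?thesis using ms by (simp add: Int_absorb2 sets.sets_into_space)
qed

lemma reneged_eq:
  assumes t: "0 \<le> t"
  shows "(LINT p:{0..t} \<times> {0..}|G. indicator {0..max 0 (left_lim X (fst p) - 1 / real n)} (snd p)) =
    measure G (reneging \<inter> {0<..t} \<times> {0..})"
proof -
  let ?B = "reneging \<inter> {0<..t} \<times> {0..}"
  let ?C = "{0} \<times> {0..max 0 (left_lim X 0 - 1 / real n)}"
  let ?f = "\<lambda>p. indicator ({0..t} \<times> {0..}) p *\<^sub>R (indicator {0..max 0 (left_lim X (fst p) - 1 / real n)} (snd p) :: real)"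
  have ms: "?B \<in> sets G"
    using reneging_borel by (intro sets_G_I) (auto simp: borel_Times)
  have "?C \<in> sets G" by (intro sets_G_I) (auto simp: borel_Times)
  then have ms': "?B \<union> ?C \<in> sets G" using ms by auto
  have f_eq: "?f = indicator (?B \<union> ?C)"
    using t by (auto simp: reneging_def indicator_def fun_eq_iff)
  have "AE p in G. p \<notin> {0} \<times> {0..}"
    using null_G sets_G_I[of "{0} \<times> {0..}"]
    by (intro AE_I[of _ _ "{0} \<times> {0..}"]) (auto simp: borel_Times)
  then have "AE p in G. ?f p = indicator ?B p"
    by eventually_elim (subst fun_cong[OF f_eq], auto simp: indicator_def)
  moreover have "?f \<in> borel_measurable G"
    unfolding f_eq using ms' by (rule borel_measurable_indicator)
  ultimately have "(LINT p|G. ?f p) = (LINT p|G. indicator ?B p)"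
    using ms by (intro integral_cong_AE) (auto intro: borel_measurable_indicator)
  then show ?thesis
    using ms by (simp add: set_lebesgue_integral_def Int_absorb2 sets.sets_into_space)
qed

lemma R_nonneg: "0 \<le> t \<Longrightarrow> 0 \<le> R t"
  by (simp add: R_eq reneged_eq)

lemma X_plus_R: "0 \<le> t \<Longrightarrow> X t + R t = x + a 0 t - measure S (busy \<inter> {0<..t}) / real n"
  by (simp add: X_eq arrivals_eq served_eq a_def)

lemma R_0: "R 0 = 0" and X_0: "X 0 = x"
proof -
  show "R 0 = 0" using R_eq[of 0] unfolding reneged_eq[OF order_refl] by simp
  then show "X 0 = x" using X_plus_R[of 0] by (simp add: a_def)
qed

lemma X_le: "0 \<le> t \<Longrightarrow> X t \<le> x + a 0 t"
  using X_plus_R[of t] R_nonneg[of t] measure_nonneg[of S "busy \<inter> {0<..t}"] n_pos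
  by (smt (verit) divide_nonneg_nonneg of_nat_0_le_iff)

lemma left_lim_X_le: "0 < u \<Longrightarrow> u \<le> t \<Longrightarrow> left_lim X u \<le> x + a 0 t"
proof (rule left_lim_le[of 0])
  fix v assume "0 < u" "u \<le> t" "0 \<le> v" "v < u"
  then show "X v \<le> x + a 0 t"
    using X_le[of v] a_add[of 0 v t] a_nonneg[of v t] by linarith
qed auto

text \<open>\<open>d\<close> is the rescaled number of services actually rendered and
  \<open>b s t - d\<close> the part lost to idling.\<close>

lemma increment:
  assumes st: "0 \<le> s" "s \<le> t"
  obtains d where "0 \<le> d" "d \<le> b s t" "X t + R t = X s + R s + a s t - d"
    "(\<And>u. s < u \<Longrightarrow> u \<le> t \<Longrightarrow> left_lim X u \<noteq> 0) \<Longrightarrow> d = b s t"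
proof
  let ?d = "measure S (busy \<inter> {s<..t}) / real n"
  show "0 \<le> ?d" by simp
  show "?d \<le> b s t"
    unfolding b_def using st busy_borel
    by (intro divide_right_mono measure_mono_fmeasurable fmeasurable_S[of _ t] sets_S_I) auto
  have "measure S (busy \<inter> {0<..s} \<union> busy \<inter> {s<..t}) =
      measure S (busy \<inter> {0<..s}) + measure S (busy \<inter> {s<..t})"
    using st busy_borel by (intro measure_Union sets_S_I finite_S_subset[of _ t]) auto
  then have "measure S (busy \<inter> {0<..t}) = measure S (busy \<inter> {0<..s}) + measure S (busy \<inter> {s<..t})"
    using st by (simp add: ivl_disj_un_two flip: Int_Un_distrib)
  then show "X t + R t = X s + R s + a s t - ?d"
    using X_plus_R[of s] X_plus_R[of t] a_add[of 0 s t] st by (simp add: add_divide_distrib)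
  assume "\<And>u. s < u \<Longrightarrow> u \<le> t \<Longrightarrow> left_lim X u \<noteq> 0"
  then have "busy \<inter> {s<..t} = {s<..t}" using st by (auto simp: busy_def)
  then show "?d = b s t" by (simp add: b_def)
qed

text \<open>\<open>measure\<close> is 0 on sets of infinite mass, so additivity of \<open>R\<close>
  in time has to be secured by finiteness. Up to time \<open>t\<close> the queue stays below
  \<open>x + a 0 t\<close>, which confines the effective marks to a bounded box.\<close>

lemma reneging_finite:
  assumes "0 \<le> t"
  shows "emeasure G (reneging \<inter> {0<..t} \<times> {0..}) \<noteq> \<infinity>"
proof (rule finite_G_subset[of _ t "max 0 (x + a 0 t)"], safe)
  fix u y assume "(u, y) \<in> reneging" "u \<in> {0<..t}"
  then have "left_lim X u \<le> x + a 0 t" "y \<le> max 0 (left_lim X u - 1 / real n)" "0 \<le> y"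
    using left_lim_X_le[of u t] by (auto simp: reneging_def)
  moreover have "0 \<le> 1 / real n" by simp
  ultimately have "y \<le> max 0 (x + a 0 t)" by linarith
  then show "y \<in> {0..max 0 (x + a 0 t)}" using \<open>0 \<le> y\<close> by simp
qed auto

lemma R_increment:
  assumes st: "0 \<le> s" "s \<le> t"
  shows "R t = R s + measure G (reneging \<inter> {s<..t} \<times> {0..}) / real n"
proof -
  have fin: "B \<subseteq> reneging \<inter> {0<..t} \<times> {0..} \<Longrightarrow> emeasure G B \<noteq> \<infinity>" for B
    using reneging_finite[of t] st emeasure_mono[of B "reneging \<inter> {0<..t} \<times> {0..}" G]
      sets_G_I[of "reneging \<inter> {0<..t} \<times> {0..}"] reneging_borel
    by (force simp: top_unique borel_Times)
  have "measure G (reneging \<inter> {0<..s} \<times> {0..} \<union> reneging \<inter> {s<..t} \<times> {0..}) =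
      measure G (reneging \<inter> {0<..s} \<times> {0..}) + measure G (reneging \<inter> {s<..t} \<times> {0..})"
    using st reneging_borel
    by (intro measure_Union sets_G_I fin) (auto simp: borel_Times)
  then have "measure G (reneging \<inter> {0<..t} \<times> {0..}) =
      measure G (reneging \<inter> {0<..s} \<times> {0..}) + measure G (reneging \<inter> {s<..t} \<times> {0..})"
    using st by (simp add: ivl_disj_un_two flip: Int_Un_distrib Sigma_Un_distrib1)
  then show ?thesis
    using st by (simp add: R_eq reneged_eq add_divide_distrib)
qed

lemma R_mono: "0 \<le> s \<Longrightarrow> s \<le> t \<Longrightarrow> R s \<le> R t"
  by (simp add: R_increment[of s t])

lemma R_increment_le:
  assumes st: "0 \<le> s" "s \<le> t" and c: "0 \<le> c"
    and le: "\<And>u. s < u \<Longrightarrow> u \<le> t \<Longrightarrow> left_lim X u \<le> c"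
  shows "R t - R s \<le> g s t c"
proof -
  have "reneging \<inter> {s<..t} \<times> {0..} \<subseteq> {s<..t} \<times> {0..c}"
  proof safe
    fix u y assume "(u, y) \<in> reneging" "u \<in> {s<..t}"
    then have "left_lim X u \<le> c" "y \<le> max 0 (left_lim X u - 1 / real n)" "0 \<le> y"
      using le by (auto simp: reneging_def)
    moreover have "0 \<le> 1 / real n" by simp
    ultimately have "y \<le> c" using c by linarith
    then show "y \<in> {0..c}" using \<open>0 \<le> y\<close> by simp
  qed
  then have "measure G (reneging \<inter> {s<..t} \<times> {0..}) \<le> measure G ({s<..t} \<times> {0..c})"
    using st reneging_borel
    by (intro measure_mono_fmeasurable fmeasurable_G[of _ t c] sets_G_I) (auto simp: borel_Times)
  then show ?thesis using st by (simp add: R_increment[of s t] g_def divide_right_mono)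
qed

text \<open>The extra \<open>1 / real n\<close> stands for the customer in service, who does not
  renege.\<close>

lemma R_increment_ge:
  assumes st: "0 \<le> s" "s \<le> t"
    and ge: "\<And>u. s < u \<Longrightarrow> u \<le> t \<Longrightarrow> c + 1 / real n \<le> left_lim X u"
  shows "g s t c \<le> R t - R s"
proof -
  have sub: "{s<..t} \<times> {0..c} \<subseteq> reneging \<inter> {s<..t} \<times> {0..}"
  proof safe
    fix u y assume "u \<in> {s<..t}" "y \<in> {0..c}"
    then have "c + 1 / real n \<le> left_lim X u" "y \<le> c" "0 \<le> y" "0 < u" using ge st by auto
    then show "(u, y) \<in> reneging" by (auto simp: reneging_def)
  qed auto
  have "reneging \<inter> {s<..t} \<times> {0..} \<subseteq> reneging \<inter> {0<..t} \<times> {0..}" using st by auto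
  from emeasure_mono[OF this, of G] have "emeasure G (reneging \<inter> {s<..t} \<times> {0..}) < \<infinity>"
    using reneging_finite[of t] st reneging_borel
      sets_G_I[of "reneging \<inter> {0<..t} \<times> {0..}"]
    by (force simp: less_top[symmetric] top_unique borel_Times)
  then have "measure G ({s<..t} \<times> {0..c}) \<le> measure G (reneging \<inter> {s<..t} \<times> {0..})"
    using st reneging_borel sub
    by (intro measure_mono_fmeasurable fmeasurableI sets_G_I) (auto simp: borel_Times intro!: sets_G_I)
  then show ?thesis using st by (simp add: R_increment[of s t] g_def divide_right_mono)
qed

section \<open>Gain of the potential over one cell and over the grid\<close>

lemma X_le_of_arrivals:
  assumes "0 \<le> s" "s \<le> v" "v \<le> t"
  shows "X v \<le> X s + a s t"
proof -
  obtain d where "0 \<le> d" "X v + R v = X s + R s + a s v - d"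
    using increment[of s v] assms by metis
  then show ?thesis
    using R_mono[of s v] a_add[of s v t] a_nonneg[of v t] assms by linarith
qed

lemma X_ge_of_departures:
  assumes "0 \<le> s" "s \<le> v" "v \<le> t"
  shows "X s - b s t - (R t - R s) \<le> X v"
proof -
  obtain d where "d \<le> b s v" "X v + R v = X s + R s + a s v - d"
    using increment[of s v] assms by metis
  then show ?thesis
    using R_mono[of v t] b_add[of s v t] b_nonneg[of v t] a_nonneg[of s v] assms by linarith
qed

text \<open>With \<open>p\<close> the slope at \<open>X s\<close> and \<open>r\<close> the reneging
  in the cell, \<open>soft_pos_step\<close> bounds the gain by \<open>p * (X t - X s) + r\<close>
  and a quadratic term. The increment of \<open>X\<close> turns the linear part into
  \<open>(1 - p) * r + p * (a s t - b s t) + p * (b s t - d)\<close>: reneging that the queue does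
  not offset, netput, and lost services. The queue bound \<open>M\<close> replaces \<open>r\<close>
  by a count over a box that does not depend on the path of \<open>X\<close>.\<close>

lemma soft_increment:
  assumes st: "0 \<le> s" "s \<le> t" and \<kappa>: "0 < \<kappa>" and a: "a s t \<le> \<kappa>"
    and M: "0 \<le> M" "\<And>u. s < u \<Longrightarrow> u \<le> t \<Longrightarrow> left_lim X u \<le> M"
  shows "R t + soft_pos \<kappa> (X t) \<le> R s + soft_pos \<kappa> (X s) + max 0 (a s t - b s t)
     + g s t (2 * \<kappa>) + 2 / \<kappa> * (a s t + b s t + g s t M)\<^sup>2"
proof -
  obtain d where d: "0 \<le> d" "d \<le> b s t" "X t + R t = X s + R s + a s t - d"
    "(\<And>u. s < u \<Longrightarrow> u \<le> t \<Longrightarrow> left_lim X u \<noteq> 0) \<Longrightarrow> d = b s t"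
    using increment[OF st] by metis
  define r where "r = R t - R s"
  define p where "p = soft_pos_slope \<kappa> (X s)"
  define q where "q = a s t + b s t + g s t M"
  have r: "0 \<le> r" "r \<le> g s t M"
    using R_mono[OF st] R_increment_le[OF st M] by (auto simp: r_def)
  have p: "0 \<le> p" "p \<le> 1" by (auto simp: p_def soft_pos_slope_def)
  note ab = a_nonneg[of s t] b_nonneg[of s t]
  \<comment> \<open>For \<open>X s\<close> above \<kappa> the factor is 0. Otherwise the arrivals,
    at most \<kappa>, keep the queue below \<open>2 * \<kappa>\<close> during the whole
    cell.\<close>
  have 1: "(1 - p) * r \<le> g s t (2 * \<kappa>)"
  proof (cases "\<kappa> \<le> X s")
    case True
    then have "p = 1" using \<kappa> by (simp add: p_def soft_pos_slope_def)
    then show ?thesis using g_nonneg by simp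
  next
    case False
    have "left_lim X u \<le> 2 * \<kappa>" if "s < u" "u \<le> t" for u
    proof (rule left_lim_le[OF st(1) that(1)])
      fix v assume "s \<le> v" "v < u"
      then show "X v \<le> 2 * \<kappa>" using X_le_of_arrivals[of s v t] st that False a by linarith
    qed
    then have "r \<le> g s t (2 * \<kappa>)"
      unfolding r_def using \<kappa> by (intro R_increment_le st) auto
    moreover have "(1 - p) * r \<le> 1 * r" using p r by (intro mult_right_mono) auto
    ultimately show ?thesis by simp
  qed
  \<comment> \<open>A lost service requires an empty queue within the cell. Then \<open>X s\<close>
    is at most the departures, hence at most \<open>q\<close>, and the slope at most
    \<open>q / \<kappa>\<close>, so the loss is of second order.\<close>
  have 2: "p * (b s t - d) \<le> q\<^sup>2 / \<kappa>"
  proof (cases "d = b s t")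
    case False
    then obtain u where u: "s < u" "u \<le> t" "left_lim X u = 0" using d(4) by blast
    have "X s - b s t - r \<le> left_lim X u"
    proof (rule left_lim_ge[OF st(1) u(1)])
      fix v assume "s \<le> v" "v < u"
      then show "X s - b s t - r \<le> X v" using X_ge_of_departures[of s v t] st u by (simp add: r_def)
    qed
    then have "X s \<le> q" using u r ab by (simp add: q_def)
    moreover have "0 \<le> q" using ab g_nonneg[of s t M] by (simp add: q_def)
    ultimately have "p \<le> q / \<kappa>"
      using \<kappa> divide_right_mono[of "X s" q \<kappa>] by (auto simp: p_def soft_pos_slope_def min_def max_def)
    moreover have "b s t - d \<le> q" using d ab g_nonneg[of s t M] by (simp add: q_def)
    ultimately have "p * (b s t - d) \<le> (q / \<kappa>) * q" using p d by (intro mult_mono) auto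
    then show ?thesis by (simp add: power2_eq_square)
  qed (use \<kappa> in simp)
  have 3: "(X t - X s)\<^sup>2 / (2 * \<kappa>) \<le> q\<^sup>2 / \<kappa>"
  proof -
    have "\<bar>X t - X s\<bar> \<le> \<bar>q\<bar>" using d r ab by (simp add: q_def r_def)
    then have "(X t - X s)\<^sup>2 \<le> q\<^sup>2" by (simp add: abs_le_square_iff)
    then show ?thesis using \<kappa> by (simp add: field_simps) (smt (verit) zero_le_power2)
  qed
  have 4: "p * (a s t - b s t) \<le> max 0 (a s t - b s t)"
    using p mult_right_mono[of p 1 "a s t - b s t"] mult_nonneg_nonpos[of p "a s t - b s t"]
    by (cases "0 \<le> a s t - b s t") auto
  have "X t - X s = a s t - d - r" using d(3) by (simp add: r_def)
  then have "p * (X t - X s) + r = (1 - p) * r + p * (a s t - b s t) + p * (b s t - d)"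
    by (simp only:) (simp add: algebra_simps)
  moreover have "2 / \<kappa> * q\<^sup>2 = q\<^sup>2 / \<kappa> + q\<^sup>2 / \<kappa>" by simp
  ultimately show ?thesis
    using soft_pos_step[OF \<kappa>, of "X t" "X s"] 1 2 3 4 by (simp add: r_def p_def q_def)
qed

text \<open>Squared cell counts are summed as largest times total: three counts of at most \<delta>
  each give \<open>3 * \<delta>\<close> times the cell total, and with the factor
  \<open>2 / \<kappa>\<close> this is the constant \<open>6 * \<delta> / \<kappa>\<close> in front
  of the totals over \<open>(0, t]\<close>. At the two ends of the sum, \<open>soft_pos\<close> is
  at most \<open>x\<close> and at least 0.\<close>

lemma R_grid_bound:
  assumes t: "0 < t" and m: "0 < m" and \<kappa>: "0 < \<kappa>" and x: "0 \<le> x"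
    and M: "x + a 0 t \<le> M" and \<delta>: "\<delta> \<le> \<kappa>"
    and small: "\<And>i. i < m \<Longrightarrow> a (grid t m i) (grid t m (Suc i)) \<le> \<delta>"
      "\<And>i. i < m \<Longrightarrow> b (grid t m i) (grid t m (Suc i)) \<le> \<delta>"
      "\<And>i. i < m \<Longrightarrow> g (grid t m i) (grid t m (Suc i)) M \<le> \<delta>"
  shows "R t \<le> x + (\<Sum>i<m. max 0 (a (grid t m i) (grid t m (Suc i)) - b (grid t m i) (grid t m (Suc i))))
     + g 0 t (2 * \<kappa>) + 6 * \<delta> / \<kappa> * (a 0 t + b 0 t + g 0 t M)"
proof -
  let ?s = "grid t m"
  have le_t: "?s i \<le> t" if "i \<le> m" for i using grid_mono[of t i m m] t m that by simp
  have M0: "0 \<le> M" using M x a_nonneg[of 0 t] by simp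
  have "R (?s k) + soft_pos \<kappa> (X (?s k)) \<le> x + (\<Sum>i<k. max 0 (a (?s i) (?s (Suc i)) - b (?s i) (?s (Suc i))))
     + g 0 (?s k) (2 * \<kappa>) + 6 * \<delta> / \<kappa> * (a 0 (?s k) + b 0 (?s k) + g 0 (?s k) M)" if "k \<le> m" for k
    using that
  proof (induction k)
    case 0
    show ?case using soft_pos_le[OF \<kappa> x] by (simp add: R_0 X_0 a_def b_def g_def)
  next
    case (Suc k)
    let ?u = "?s k" and ?v = "?s (Suc k)"
    let ?q = "a ?u ?v + b ?u ?v + g ?u ?v M"
    have uv: "0 \<le> ?u" "?u \<le> ?v" using t by (auto intro: grid_mono)
    have k: "k < m" using Suc by simp
    have "left_lim X u \<le> M" if "?u < u" "u \<le> ?v" for u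
      using left_lim_X_le[of u t] le_t[of "Suc k"] that uv Suc.prems M by linarith
    moreover have "a ?u ?v \<le> \<kappa>" using small(1)[OF k] \<delta> by linarith
    ultimately have step: "R ?v + soft_pos \<kappa> (X ?v) \<le> R ?u + soft_pos \<kappa> (X ?u) + max 0 (a ?u ?v - b ?u ?v)
       + g ?u ?v (2 * \<kappa>) + 2 / \<kappa> * ?q\<^sup>2"
      using soft_increment[OF uv \<kappa> _ M0] by blast
    have "?q\<^sup>2 \<le> (3 * \<delta>) * ?q"
      unfolding power2_eq_square
      using small[OF k] a_nonneg[of ?u ?v] b_nonneg[of ?u ?v] g_nonneg[of ?u ?v M]
      by (intro mult_right_mono) auto
    then have "2 / \<kappa> * ?q\<^sup>2 \<le> 2 / \<kappa> * ((3 * \<delta>) * ?q)" using \<kappa> by (intro mult_left_mono) auto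
    then have "2 / \<kappa> * ?q\<^sup>2 \<le> 6 * \<delta> / \<kappa> * ?q" by simp
    moreover have "6 * \<delta> / \<kappa> * (a 0 ?v + b 0 ?v + g 0 ?v M) =
        6 * \<delta> / \<kappa> * (a 0 ?u + b 0 ?u + g 0 ?u M) + 6 * \<delta> / \<kappa> * ?q"
      unfolding a_add[OF order_refl uv] b_add[OF order_refl uv] g_add[OF order_refl uv]
      by (simp add: distrib_left)
    ultimately show ?case
      using step Suc.IH k g_add[OF order_refl uv, of "2 * \<kappa>"] by simp
  qed
  from this[of m] show ?thesis using m soft_pos_nonneg[OF \<kappa>, of "X t"] by simp
qed

text \<open>The queue grows by arrivals only. If it is long at \<open>t\<close> even after removing
  the arrivals of the window, it was long throughout the window, and all marks up to
  \<open>y\<close> count.\<close>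

lemma R_ge_window:
  assumes "0 \<le> c" "c \<le> t" and ge: "y + 1 / real n \<le> X t - a (t - c) t"
  shows "g (t - c) t y \<le> R t"
proof -
  have "g (t - c) t y \<le> R t - R (t - c)"
  proof (rule R_increment_ge)
    fix u assume u: "t - c < u" "u \<le> t"
    show "y + 1 / real n \<le> left_lim X u"
    proof (rule left_lim_ge[of "t - c"])
      fix v assume v: "t - c \<le> v" "v < u"
      have "X t \<le> X v + a v t" using X_le_of_arrivals[of v t t] v u assms by simp
      moreover have "a v t \<le> a (t - c) t"
        using a_add[of "t - c" v t] a_nonneg[of "t - c" v] v u assms by simp
      ultimately show "y + 1 / real n \<le> X v" using ge by linarith
    qed (use u assms in auto)
  qed (use assms in auto)
  then show ?thesis using R_nonneg[of "t - c"] assms by simp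
qed

lemma X_plus_R_ge:
  assumes "0 \<le> t"
  shows "x + a 0 t - b 0 t \<le> X t + R t"
  using increment[of 0 t] assms X_0 R_0 by (metis add.right_neutral diff_left_mono order_refl)

end

section \<open>Poisson random measures\<close>

lemma random_measure_measurable:
  "random_measure M E N \<Longrightarrow> B \<in> sets E \<Longrightarrow> (\<lambda>\<omega>. emeasure (N \<omega>) B) \<in> borel_measurable M"
  by (simp add: random_measure_def)

lemma random_measure_measurable_measure:
  assumes "random_measure M E N" "B \<in> sets E"
  shows "(\<lambda>\<omega>. measure (N \<omega>) B) \<in> borel_measurable M"
  using random_measure_measurable[OF assms] unfolding measure_def by measurable

lemma PRM_random_measure: "poisson_random_measure M \<nu> N \<Longrightarrow> random_measure M \<nu> N"
  by (simp add: poisson_random_measure_def)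

lemma PRM_point:
  "poisson_random_measure M \<nu> N \<Longrightarrow> B \<in> sets \<nu> \<Longrightarrow> emeasure \<nu> B < \<infinity> \<Longrightarrow>
    measure M {\<omega>\<in>space M. emeasure (N \<omega>) B = of_nat k} = measure \<nu> B ^ k / fact k * exp (- measure \<nu> B)"
  by (simp add: poisson_random_measure_def)

lemma PRM_indep:
  "poisson_random_measure M \<nu> N \<Longrightarrow> (\<And>i. i < (k::nat) \<Longrightarrow> A i \<in> sets \<nu>) \<Longrightarrow> disjoint_family_on A {..<k} \<Longrightarrow>
    prob_space.indep_vars M (\<lambda>_. borel) (\<lambda>i \<omega>. emeasure (N \<omega>) (A i)) {..<k}"
  unfolding poisson_random_measure_def by simp

context prob_space
begin

context
  fixes \<nu> :: "'e measure" and N B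
  assumes PRM: "poisson_random_measure M \<nu> N" and B: "B \<in> sets \<nu>" and fin: "emeasure \<nu> B < \<infinity>"
begin

lemma PRM_point_event: "{\<omega>\<in>space M. emeasure (N \<omega>) B = of_nat k} \<in> events"
  using random_measure_measurable[OF PRM_random_measure[OF PRM] B] by measurable

text \<open>Only point probabilities are prescribed, but the Poisson weights sum to 1, which leaves
  no mass for infinite or non-integer values.\<close>

lemma PRM_AE_nat: "AE \<omega> in M. \<exists>k::nat. emeasure (N \<omega>) B = of_nat k"
proof -
  let ?E = "\<lambda>k::nat. {\<omega>\<in>space M. emeasure (N \<omega>) B = of_nat k}"
  have "disjoint_family ?E" by (auto simp: disjoint_family_on_def)
  then have "(\<lambda>k. prob (?E k)) sums prob (\<Union>k. ?E k)"
    using PRM_point_event by (intro finite_measure_UNION) auto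
  moreover have "(\<lambda>k. prob (?E k)) sums 1"
  proof -
    have "(\<lambda>k. measure \<nu> B ^ k /\<^sub>R fact k * exp (- measure \<nu> B)) sums (exp (measure \<nu> B) * exp (- measure \<nu> B))"
      by (intro sums_mult2 exp_converges)
    then show ?thesis
      by (simp add: PRM_point[OF PRM B fin] exp_minus_inverse divide_inverse mult.commute)
  qed
  ultimately have "prob (\<Union>k. ?E k) = 1" by (rule sums_unique2)
  then have "AE \<omega> in M. \<omega> \<in> (\<Union>k. ?E k)"
    using PRM_point_event by (subst (asm) prob_eq_1) auto
  then show ?thesis by eventually_elim auto
qed

text \<open>The exponential series is summed over the level sets of the count, which covers mean 0
  as well. As \<beta> may have either sign, one identity serves both tails.\<close>

lemma PRM_exp_moment:
  "has_bochner_integral M (\<lambda>\<omega>. exp (\<beta> * measure (N \<omega>) B)) (exp (measure \<nu> B * (exp \<beta> - 1)))"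
proof (rule has_bochner_integral_nn_integral)
  let ?E = "\<lambda>k::nat. {\<omega>\<in>space M. emeasure (N \<omega>) B = of_nat k}"
  show "(\<lambda>\<omega>. exp (\<beta> * measure (N \<omega>) B)) \<in> borel_measurable M"
    using random_measure_measurable_measure[OF PRM_random_measure[OF PRM] B] by measurable
  have "(\<integral>\<^sup>+\<omega>. ennreal (exp (\<beta> * measure (N \<omega>) B)) \<partial>M)
      = (\<integral>\<^sup>+\<omega>. (\<Sum>k. ennreal (exp (\<beta> * real k)) * indicator (?E k) \<omega>) \<partial>M)"
  proof (rule nn_integral_cong_AE)
    from PRM_AE_nat AE_space
    show "AE \<omega> in M. ennreal (exp (\<beta> * measure (N \<omega>) B)) = (\<Sum>k. ennreal (exp (\<beta> * real k)) * indicator (?E k) \<omega>)"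
    proof eventually_elim
      case (elim \<omega>)
      then obtain j :: nat where j: "emeasure (N \<omega>) B = of_nat j" by auto
      then have "measure (N \<omega>) B = real j"
        by (simp add: measure_def enn2real_def ennreal_of_nat_eq_real_of_nat)
      moreover have "(\<lambda>k. ennreal (exp (\<beta> * real k)) * indicator (?E k) \<omega>) =
          (\<lambda>k. if k = j then ennreal (exp (\<beta> * real k)) else 0)"
        using j elim by (auto simp: indicator_def fun_eq_iff)
      moreover have "(\<Sum>k. if k = j then ennreal (exp (\<beta> * real k)) else 0) = ennreal (exp (\<beta> * real j))"
        by (subst suminf_finite[of "{j}"]) auto
      ultimately show ?case by simp
    qed
  qed
  also have "\<dots> = (\<Sum>k. \<integral>\<^sup>+\<omega>. ennreal (exp (\<beta> * real k)) * indicator (?E k) \<omega> \<partial>M)"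
    using PRM_point_event
    by (intro nn_integral_suminf borel_measurable_times_ennreal borel_measurable_const borel_measurable_indicator)
  also have "\<dots> = (\<Sum>k. ennreal (exp (\<beta> * real k) * (measure \<nu> B ^ k / fact k * exp (- measure \<nu> B))))"
    using PRM_point_event
    by (simp add: nn_integral_cmult_indicator emeasure_eq_measure PRM_point[OF PRM B fin] ennreal_mult'[symmetric])
  also have "\<dots> = ennreal (exp (measure \<nu> B * exp \<beta>) * exp (- measure \<nu> B))"
  proof (rule suminf_ennreal_eq)
    have "(\<lambda>k. (measure \<nu> B * exp \<beta>) ^ k /\<^sub>R fact k * exp (- measure \<nu> B)) sums
        (exp (measure \<nu> B * exp \<beta>) * exp (- measure \<nu> B))"
      by (intro sums_mult2 exp_converges)
    moreover have "(measure \<nu> B * exp \<beta>) ^ k /\<^sub>R fact k * exp (- measure \<nu> B) =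
        exp (\<beta> * real k) * (measure \<nu> B ^ k / fact k * exp (- measure \<nu> B))" for k
      unfolding exp_of_nat2_mult power_mult_distrib by (simp add: field_simps)
    ultimately show "(\<lambda>k. exp (\<beta> * real k) * (measure \<nu> B ^ k / fact k * exp (- measure \<nu> B))) sums
        (exp (measure \<nu> B * exp \<beta>) * exp (- measure \<nu> B))"
      by simp
  qed auto
  also have "exp (measure \<nu> B * exp \<beta>) * exp (- measure \<nu> B) = exp (measure \<nu> B * (exp \<beta> - 1))"
    unfolding exp_add[symmetric] by (simp add: right_diff_distrib)
  finally show "(\<integral>\<^sup>+\<omega>. ennreal (exp (\<beta> * measure (N \<omega>) B)) \<partial>M) = ennreal (exp (measure \<nu> B * (exp \<beta> - 1)))" .
qed auto

end

lemma chernoff: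
  assumes "has_bochner_integral M (\<lambda>\<omega>. exp (Z \<omega>)) e"
  shows "prob {\<omega>\<in>space M. c \<le> Z \<omega>} \<le> exp (- c) * e"
proof -
  have "prob {\<omega>\<in>space M. exp c \<le> exp (Z \<omega>)} \<le> (\<integral>\<omega>. exp (Z \<omega>) \<partial>M) / exp c"
    using assms by (intro integral_Markov_inequality_measure[where A="{}"]) (auto simp: has_bochner_integral_iff)
  then show ?thesis using assms by (simp add: has_bochner_integral_iff exp_minus divide_inverse mult.commute)
qed

lemma PRM_chernoff:
  assumes "poisson_random_measure M \<nu> N" "B \<in> sets \<nu>" "emeasure \<nu> B < \<infinity>"
  shows "prob {\<omega>\<in>space M. c \<le> \<beta> * measure (N \<omega>) B} \<le> exp (measure \<nu> B * (exp \<beta> - 1) - c)"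
  using chernoff[OF PRM_exp_moment[OF assms], of c \<beta>] unfolding exp_add[symmetric] by simp

text \<open>The real count is \<open>enn2real\<close> of the extended one and generates no further
  events, so independence of random measures passes to real counts.\<close>

lemma count_events_subset:
  assumes "B \<in> sets E"
  shows "sigma_sets (space M) {(\<lambda>\<omega>. measure (N \<omega>) B) -` A \<inter> space M | A. A \<in> sets borel}
      \<subseteq> random_measure_events M E N"
  unfolding random_measure_events_def
proof (rule sigma_sets_mono, safe)
  fix A :: "real set" assume "A \<in> sets borel"
  then have "enn2real -` A \<in> sets borel"
    using measurable_sets[of enn2real borel borel A] by (simp add: borel_measurable_enn2real)
  then have "(\<lambda>\<omega>. emeasure (N \<omega>) B) -` (enn2real -` A) \<inter> space M
      \<in> {(\<lambda>\<omega>. emeasure (N \<omega>) A) -` B \<inter> space M | A B. A \<in> sets E \<and> B \<in> sets borel}"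
    using assms by blast
  moreover have "(\<lambda>\<omega>. measure (N \<omega>) B) -` A \<inter> space M = (\<lambda>\<omega>. emeasure (N \<omega>) B) -` (enn2real -` A) \<inter> space M"
    by (auto simp: measure_def)
  ultimately show "(\<lambda>\<omega>. measure (N \<omega>) B) -` A \<inter> space M \<in> sigma_sets (space M)
      {(\<lambda>\<omega>. emeasure (N \<omega>) A) -` B \<inter> space M | A B. A \<in> sets E \<and> B \<in> sets borel}"
    by (metis (no_types, lifting) sigma_sets.Basic)
qed

lemma indep_random_measures_count:
  assumes rm: "random_measure M E1 N1" "random_measure M E2 N2"
    and ind: "\<And>F1 F2. F1 \<in> random_measure_events M E1 N1 \<Longrightarrow> F2 \<in> random_measure_events M E2 N2 \<Longrightarrow>
      prob (F1 \<inter> F2) = prob F1 * prob F2"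
    and B: "B1 \<in> sets E1" "B2 \<in> sets E2"
  shows "indep_var borel (\<lambda>\<omega>. measure (N1 \<omega>) B1) borel (\<lambda>\<omega>. measure (N2 \<omega>) B2)"
  unfolding indep_var_eq
proof (intro conjI indep_setI)
  show m1: "(\<lambda>\<omega>. measure (N1 \<omega>) B1) \<in> borel_measurable M" "(\<lambda>\<omega>. measure (N2 \<omega>) B2) \<in> borel_measurable M"
    using random_measure_measurable_measure rm B by blast+
  show "sigma_sets (space M) {(\<lambda>\<omega>. measure (N1 \<omega>) B1) -` A \<inter> space M | A. A \<in> sets borel} \<subseteq> events"
    "sigma_sets (space M) {(\<lambda>\<omega>. measure (N2 \<omega>) B2) -` A \<inter> space M | A. A \<in> sets borel} \<subseteq> events"
    using m1 by (auto intro!: sets.sigma_sets_subset measurable_sets)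
qed (rule ind; erule subsetD[OF count_events_subset[OF B(1)]] subsetD[OF count_events_subset[OF B(2)]])

text \<open>Two separate tilts, since opposite signs give the tails of a difference of
  counts.\<close>

lemma PRM_chernoff_pair:
  assumes PRM: "poisson_random_measure M \<nu>1 N1" "poisson_random_measure M \<nu>2 N2"
    and ind: "\<And>F1 F2. F1 \<in> random_measure_events M \<nu>1 N1 \<Longrightarrow> F2 \<in> random_measure_events M \<nu>2 N2 \<Longrightarrow>
      prob (F1 \<inter> F2) = prob F1 * prob F2"
    and B: "B1 \<in> sets \<nu>1" "B2 \<in> sets \<nu>2" "emeasure \<nu>1 B1 < \<infinity>" "emeasure \<nu>2 B2 < \<infinity>"
  shows "prob {\<omega>\<in>space M. c \<le> \<beta>1 * measure (N1 \<omega>) B1 + \<beta>2 * measure (N2 \<omega>) B2}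
    \<le> exp (measure \<nu>1 B1 * (exp \<beta>1 - 1) + measure \<nu>2 B2 * (exp \<beta>2 - 1) - c)"
proof -
  let ?f1 = "\<lambda>\<omega>. exp (\<beta>1 * measure (N1 \<omega>) B1)" and ?f2 = "\<lambda>\<omega>. exp (\<beta>2 * measure (N2 \<omega>) B2)"
  have "indep_var borel (\<lambda>\<omega>. measure (N1 \<omega>) B1) borel (\<lambda>\<omega>. measure (N2 \<omega>) B2)"
    by (rule indep_random_measures_count[OF PRM(1)[THEN PRM_random_measure] PRM(2)[THEN PRM_random_measure] _ B(1,2)])
       (rule ind)
  from indep_var_compose[OF this, of "\<lambda>y. exp (\<beta>1 * y)" borel "\<lambda>y. exp (\<beta>2 * y)" borel]
  have ind': "indep_var borel ?f1 borel ?f2" by (simp add: o_def)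
  note m = PRM_exp_moment[OF PRM(1) B(1,3), of \<beta>1] PRM_exp_moment[OF PRM(2) B(2,4), of \<beta>2]
  then have i: "integrable M ?f1" "integrable M ?f2" by (auto simp: has_bochner_integral_iff)
  have "has_bochner_integral M (\<lambda>\<omega>. exp (\<beta>1 * measure (N1 \<omega>) B1 + \<beta>2 * measure (N2 \<omega>) B2))
      (exp (measure \<nu>1 B1 * (exp \<beta>1 - 1)) * exp (measure \<nu>2 B2 * (exp \<beta>2 - 1)))"
    using indep_var_integrable[OF ind' i] indep_var_lebesgue_integral[OF ind' i] m
    by (simp add: has_bochner_integral_iff exp_add)
  from chernoff[OF this, of c] show ?thesis unfolding exp_add[symmetric] by (simp add: add_ac)
qed

lemma PRM_product_point:
  assumes PRM: "poisson_random_measure M \<nu> N"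
    and B: "\<And>i. i < m \<Longrightarrow> B i \<in> sets \<nu>" "disjoint_family_on B {..<m}" "0 < (m::nat)"
  shows "prob {\<omega>\<in>space M. \<forall>i<m. emeasure (N \<omega>) (B i) = of_nat j} =
    (\<Prod>i<m. prob {\<omega>\<in>space M. emeasure (N \<omega>) (B i) = of_nat j})"
proof -
  have "indep_vars (\<lambda>_. borel) (\<lambda>i \<omega>. emeasure (N \<omega>) (B i)) {..<m}"
    using PRM B by (intro PRM_indep)
  then have "prob (\<Inter>i<m. (\<lambda>\<omega>. emeasure (N \<omega>) (B i)) -` {of_nat j} \<inter> space M) =
      (\<Prod>i<m. prob ((\<lambda>\<omega>. emeasure (N \<omega>) (B i)) -` {of_nat j} \<inter> space M))"
    by (rule indep_varsD_finite) (use B(3) in auto)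
  moreover have "(\<Inter>i<m. (\<lambda>\<omega>. emeasure (N \<omega>) (B i)) -` {of_nat j} \<inter> space M) =
      {\<omega>\<in>space M. \<forall>i<m. emeasure (N \<omega>) (B i) = of_nat j}"
    using B(3) by auto
  moreover have "(\<lambda>\<omega>. emeasure (N \<omega>) (B i)) -` {of_nat j} \<inter> space M = {\<omega>\<in>space M. emeasure (N \<omega>) (B i) = of_nat j}" for i
    by auto
  ultimately show ?thesis by simp
qed

end

section \<open>A Stirling bound for Poisson weights\<close>

lemma ln_fact_le:
  assumes "1 \<le> j"
  shows "ln (fact j) \<le> real j * ln (real j) - real j + ln (real j) + 1"
  using assms
proof (induction j rule: dec_induct)
  case (step j)
  have j: "0 < real j" using step by simp
  \<comment> \<open>\<open>ln y \<le> y - 1\<close> at \<open>y = j / (j + 1)\<close> becomes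
    \<open>1 \<le> (j + 1) * (ln (j + 1) - ln j)\<close>, exactly what the induction step
    consumes.\<close>
  have "ln (real j / real (Suc j)) \<le> real j / real (Suc j) - 1" using j by (intro ln_le_minus_one) auto
  then have "1 / real (Suc j) \<le> ln (real (Suc j)) - ln (real j)" using j by (simp add: ln_div field_simps)
  then have "real (Suc j) * (1 / real (Suc j)) \<le> real (Suc j) * (ln (real (Suc j)) - ln (real j))"
    by (intro mult_left_mono) auto
  then have "1 \<le> real (Suc j) * ln (real (Suc j)) - real (Suc j) * ln (real j)"
    by (simp add: right_diff_distrib del: of_nat_Suc)
  moreover have "ln (fact (Suc j) :: real) = ln (real (Suc j)) + ln (fact j)"
    by (simp add: ln_mult del: of_nat_Suc)
  ultimately show ?case using step by (simp add: algebra_simps)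
qed simp

text \<open>\<open>r - a + a * ln (a / r)\<close> is the relative entropy of the Poisson law of mean
  \<open>a\<close> with respect to that of mean \<open>r\<close>. Rounding \<open>n * a\<close> to
  an integer and the Stirling error cost a constant plus \<open>ln (n * a)\<close>, eventually less
  than \<open>n * \<epsilon>\<close>.\<close>

lemma poisson_point_lower_bound:
  fixes r a \<epsilon> :: real
  assumes r: "0 < r" and a: "0 < a" and \<epsilon>: "0 < \<epsilon>"
  shows "\<forall>\<^sub>F n in sequentially. exp (- real n * (r - a + a * ln (a / r) + \<epsilon>)) \<le>
    (real n * r) ^ nat \<lfloor>real n * a\<rfloor> / fact (nat \<lfloor>real n * a\<rfloor>) * exp (- (real n * r))"
proof -
  \<comment> \<open>The main term \<open>j * (1 - ln (a / r))\<close> is linear in \<open>j\<close>;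
    replacing \<open>n * a\<close> by its floor changes it by at most \<open>L\<close>.\<close>
  define L where "L = \<bar>1 - ln (a / r)\<bar>"
  have "((\<lambda>n. (L + 1 + ln (real n * a)) / real n) \<longlongrightarrow> 0) sequentially"
    using a by real_asymp
  then have ev: "\<forall>\<^sub>F n in sequentially. (L + 1 + ln (real n * a)) / real n < \<epsilon>"
    using \<epsilon> order_tendstoD(2) by blast
  have "\<forall>\<^sub>F n in sequentially. 1 \<le> real n * a" using a by real_asymp
  with ev eventually_gt_at_top[of 0] show ?thesis
  proof eventually_elim
    case (elim n)
    define j where "j = nat \<lfloor>real n * a\<rfloor>"
    have j: "1 \<le> j" "real j \<le> real n * a" "real n * a - 1 \<le> real j"
      using elim unfolding j_def by (auto simp: le_nat_iff le_floor_iff)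
    have n: "0 < real n" using elim by simp
    have small: "L + 1 + ln (real n * a) \<le> real n * \<epsilon>"
      using elim n by (simp add: pos_divide_less_eq mult.commute)
    have lnj: "ln (real j) \<le> ln (real n * a)" using j by simp
    have "ln ((real n * r) ^ j / fact j * exp (- (real n * r))) =
        real j * ln (real n * r) - ln (fact j) - real n * r"
      using n r by (simp add: ln_mult ln_div ln_realpow)
    also have "\<dots> \<ge> real j * ln (real n * r) - (real j * ln (real j) - real j + ln (real j) + 1) - real n * r"
      using ln_fact_le[OF j(1)] by simp
    finally have 1: "ln ((real n * r) ^ j / fact j * exp (- (real n * r))) \<ge>
        real j * ln (real n * r) - (real j * ln (real j) - real j + ln (real j) + 1) - real n * r" .
    have "real j * ln (real j) \<le> real j * ln (real n * a)" using lnj by (intro mult_left_mono) auto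
    moreover have "ln (real n * a) = ln (real n * r) + ln (a / r)" using n a r by (simp add: ln_mult ln_div)
    ultimately have 2: "real j * ln (real n * r) - real j * ln (real j) + real j \<ge> real j * (1 - ln (a / r))"
      by (simp add: algebra_simps)
    have "\<bar>(real n * a - real j) * (1 - ln (a / r))\<bar> \<le> 1 * L"
      unfolding abs_mult L_def using j by (intro mult_mono) auto
    then have "real n * a * (1 - ln (a / r)) - L \<le> real j * (1 - ln (a / r))"
      by (simp add: left_diff_distrib)
    then have "- real n * (r - a + a * ln (a / r) + \<epsilon>) \<le> ln ((real n * r) ^ j / fact j * exp (- (real n * r)))"
      using 1 2 small lnj by (simp add: algebra_simps)
    then have "exp (- real n * (r - a + a * ln (a / r) + \<epsilon>)) \<le> exp (ln ((real n * r) ^ j / fact j * exp (- (real n * r))))"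
      by (simp only: exp_le_cancel_iff)
    also have "\<dots> = (real n * r) ^ j / fact j * exp (- (real n * r))"
      using n r by (intro exp_ln) simp
    finally show ?case by (simp add: j_def)
  qed
qed

section \<open>Exponential estimates for a single system\<close>

lemma sets_time_intensity: "sets (time_intensity r) = sets (restrict_space lborel {0..})"
  by (simp add: time_intensity_def)

lemma sets_time_mark_intensity: "sets (time_mark_intensity r) = sets (restrict_space lborel ({0..} \<times> {0..}))"
  by (simp add: time_mark_intensity_def)

lemma sets_time_intensityI: "B \<in> sets borel \<Longrightarrow> B \<subseteq> {0..} \<Longrightarrow> B \<in> sets (time_intensity r)"
  unfolding sets_time_intensity by (subst sets_restrict_space_iff) auto

lemma sets_time_mark_intensityI:
  "B \<in> sets borel \<Longrightarrow> B \<subseteq> {0..} \<times> {0..} \<Longrightarrow> B \<in> sets (time_mark_intensity r)"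
  unfolding sets_time_mark_intensity by (subst sets_restrict_space_iff) (auto simp: borel_Times)

lemma emeasure_time_intensity:
  assumes "B \<in> sets borel" "B \<subseteq> {0..}"
  shows "emeasure (time_intensity r) B = ennreal r * emeasure lborel B"
  using assms by (simp add: time_intensity_def emeasure_restrict_space)

lemma emeasure_time_mark_intensity:
  assumes "B \<in> sets borel" "C \<in> sets borel" "B \<subseteq> {0..}" "C \<subseteq> {0..}"
  shows "emeasure (time_mark_intensity r) (B \<times> C) = ennreal r * (emeasure lborel B * emeasure lborel C)"
proof -
  have "emeasure (lborel :: (real \<times> real) measure) (B \<times> C) = emeasure lborel B * emeasure lborel C"
    using assms by (subst lborel_prod[symmetric], subst lborel.emeasure_pair_measure_Times) auto
  moreover have "B \<times> C \<subseteq> {0..} \<times> {0..}" using assms by auto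
  ultimately show ?thesis
    using assms by (simp add: time_mark_intensity_def emeasure_restrict_space borel_Times)
qed

lemma emeasure_time_intensity_Ioc:
  assumes "0 \<le> s" "s \<le> t" "0 \<le> r"
  shows "emeasure (time_intensity r) {s<..t} = ennreal (r * (t - s))"
  using assms by (subst emeasure_time_intensity) (auto simp: ennreal_mult)

lemma emeasure_time_mark_intensity_box:
  assumes "0 \<le> s" "s \<le> t" "0 \<le> r" "0 \<le> c"
  shows "emeasure (time_mark_intensity r) ({s<..t} \<times> {0..c}) = ennreal (r * (t - s) * c)"
  using assms by (subst emeasure_time_mark_intensity) (auto simp: ennreal_mult mult.assoc)

definition grid_cells :: "real \<Rightarrow> nat \<Rightarrow> nat set \<Rightarrow> real set" where
  "grid_cells t m J = (\<Union>i\<in>J. {grid t m i<..grid t m (Suc i)})"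

lemma disjoint_grid_cells: "0 \<le> t \<Longrightarrow> disjoint_family (\<lambda>i. {grid t m i<..grid t m (Suc i)})"
  unfolding disjoint_family_on_def
proof (intro ballI impI)
  fix i j :: nat assume "0 \<le> t" "i \<noteq> j"
  then show "{grid t m i<..grid t m (Suc i)} \<inter> {grid t m j<..grid t m (Suc j)} = {}"
    using grid_mono[of t "Suc i" j m] grid_mono[of t "Suc j" i m] by (cases "i < j") auto
qed

lemma emeasure_grid_cells:
  assumes "0 \<le> t" "finite J"
  shows "emeasure lborel (grid_cells t m J) = ennreal (real (card J) * (t / real m))"
proof -
  have "emeasure lborel (grid_cells t m J) = (\<Sum>i\<in>J. emeasure lborel {grid t m i<..grid t m (Suc i)})"
    unfolding grid_cells_def using assms disjoint_grid_cells[of t m]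
    by (intro sum_emeasure[symmetric]) (auto simp: disjoint_family_on_def)
  also have "\<dots> = (\<Sum>i\<in>J. ennreal (t / real m))"
    using assms by (simp add: grid_Suc)
  also have "\<dots> = ennreal (real (card J) * (t / real m))"
    using assms by (simp add: ennreal_of_nat_eq_real_of_nat flip: ennreal_mult)
  finally show ?thesis .
qed

text \<open>The Poisson weight at 0 with mean 0 is \<open>0 ^ 0 = 1\<close>.\<close>

lemma (in prob_space) AE_emeasure_zero_of_null:
  assumes "poisson_random_measure M \<nu> N" "B \<in> sets \<nu>" "emeasure \<nu> B = 0"
  shows "AE \<omega> in M. emeasure (N \<omega>) B = 0"
proof -
  have "prob {\<omega>\<in>space M. emeasure (N \<omega>) B = of_nat 0} = 1"
    using PRM_point[OF assms(1,2), of 0] assms by (simp add: measure_def)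
  then have "AE \<omega> in M. \<omega> \<in> {\<omega>\<in>space M. emeasure (N \<omega>) B = of_nat 0}"
    using PRM_point_event[OF assms(1,2), of 0] assms(3) by (subst (asm) prob_eq_1) auto
  then show ?thesis by eventually_elim auto
qed

lemma (in prob_space) AE_emeasure_finite:
  assumes "poisson_random_measure M \<nu> N" "B \<in> sets \<nu>" "emeasure \<nu> B < \<infinity>"
  shows "AE \<omega> in M. emeasure (N \<omega>) B < \<infinity>"
  using PRM_AE_nat[OF assms] by eventually_elim (auto simp: ennreal_of_nat_eq_real_of_nat)

text \<open>\<open>l\<close>, \<open>c\<close> and \<open>K\<close> are mean, threshold and rate per
  unit of \<open>n\<close>. The tilt \<beta> is left to the caller: a small mean tolerates a large
  \<beta>, which yields any rate \<open>K\<close> even at a small threshold.\<close>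

lemma (in prob_space) PRM_upper_tail:
  assumes "poisson_random_measure M \<nu> N" "B \<in> sets \<nu>" "emeasure \<nu> B = ennreal (real n * l)" "0 \<le> l"
    and "l * (exp \<beta> - 1) + K \<le> \<beta> * c" "0 \<le> \<beta>"
  shows "prob {\<omega>\<in>space M. real n * c \<le> measure (N \<omega>) B} \<le> exp (- real n * K)"
proof -
  have l: "measure \<nu> B = real n * l" using assms by (simp add: measure_def)
  have m: "(\<lambda>\<omega>. measure (N \<omega>) B) \<in> borel_measurable M"
    using random_measure_measurable_measure[OF PRM_random_measure[OF assms(1)] assms(2)] .
  have "prob {\<omega>\<in>space M. real n * c \<le> measure (N \<omega>) B} \<le>
      prob {\<omega>\<in>space M. \<beta> * (real n * c) \<le> \<beta> * measure (N \<omega>) B}"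
    using m assms(6) by (intro finite_measure_mono) (auto intro: mult_left_mono)
  also have "\<dots> \<le> exp (measure \<nu> B * (exp \<beta> - 1) - \<beta> * (real n * c))"
    using assms by (intro PRM_chernoff) auto
  also have "\<dots> = exp (real n * (l * (exp \<beta> - 1) - \<beta> * c))" by (simp add: l algebra_simps)
  also have "\<dots> \<le> exp (real n * (- K))"
    using assms(5) by (subst exp_le_cancel_iff, intro mult_left_mono) auto
  finally show ?thesis by simp
qed

text \<open>The fixed tilt \<open>- 1\<close> gives a rate proportional to the mean, and in the
  application the mean is made large.\<close>

lemma (in prob_space) PRM_lower_tail:
  assumes "poisson_random_measure M \<nu> N" "B \<in> sets \<nu>" "emeasure \<nu> B = ennreal (real n * l)" "0 \<le> l"
    and "c + K \<le> l * (1 - exp (- 1))"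
  shows "prob {\<omega>\<in>space M. measure (N \<omega>) B \<le> real n * c} \<le> exp (- real n * K)"
proof -
  have l: "measure \<nu> B = real n * l" using assms by (simp add: measure_def)
  have "prob {\<omega>\<in>space M. - (real n * c) \<le> - 1 * measure (N \<omega>) B}
      \<le> exp (measure \<nu> B * (exp (- 1) - 1) - (- (real n * c)))"
    using assms by (intro PRM_chernoff) auto
  also have "\<dots> = exp (real n * (c - l * (1 - exp (- 1))))" by (simp add: l algebra_simps)
  also have "\<dots> \<le> exp (real n * (- K))"
    using assms(5) by (subst exp_le_cancel_iff, intro mult_left_mono) auto
  finally show ?thesis by simp
qed

section \<open>Almost sure path properties of one system\<close>

locale mm1m = mm1m_system +
  assumes n_pos: "0 < n" and rates_pos: "0 < lam" "0 < mu" "0 < theta"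
begin

lemma sets_N:
  assumes "\<omega> \<in> space P"
  shows "sets (N1 \<omega>) = sets (restrict_space lborel {0..})" "sets (N2 \<omega>) = sets (restrict_space lborel {0..})"
    "sets (N3 \<omega>) = sets (restrict_space lborel ({0..} \<times> {0..}))"
  using assms PRM1 PRM2 PRM3
  by (auto simp: poisson_random_measure_def random_measure_def sets_time_intensity sets_time_mark_intensity)

text \<open>Integer horizons produce countably many null sets; monotonicity then covers all real
  \<open>t\<close> at once.\<close>

lemma AE_finite_time:
  assumes "poisson_random_measure P (time_intensity r) N"
  shows "AE \<omega> in P. \<forall>t. emeasure (N \<omega>) {0..t} < \<infinity>"
proof -
  have "AE \<omega> in P. \<forall>k::nat. emeasure (N \<omega>) {0..real k} < \<infinity>"
    unfolding AE_all_countable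
    by (intro allI AE_emeasure_finite[OF assms] sets_time_intensityI)
       (auto simp: emeasure_time_intensity ennreal_mult_less_top)
  with AE_space show ?thesis
  proof eventually_elim
    case (elim \<omega>)
    show ?case
    proof
      fix t :: real
      obtain k :: nat where "t \<le> real k" using real_arch_simple by blast
      moreover have "{0..real k} \<in> sets (N \<omega>)"
        using elim assms sets_time_intensityI[of "{0..real k}" r]
        by (auto simp: poisson_random_measure_def random_measure_def)
      ultimately have "emeasure (N \<omega>) {0..t} \<le> emeasure (N \<omega>) {0..real k}" by (intro emeasure_mono) auto
      then show "emeasure (N \<omega>) {0..t} < \<infinity>" using elim by (meson le_less_trans)
    qed
  qed
qed

lemma AE_finite_time_mark: "AE \<omega> in P. \<forall>t c. emeasure (N3 \<omega>) ({0..t} \<times> {0..c}) < \<infinity>"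
proof -
  have "AE \<omega> in P. \<forall>k::nat. emeasure (N3 \<omega>) ({0..real k} \<times> {0..real k}) < \<infinity>"
    unfolding AE_all_countable
    by (intro allI AE_emeasure_finite[OF PRM3] sets_time_mark_intensityI)
       (auto simp: emeasure_time_mark_intensity ennreal_mult_less_top borel_Times)
  with AE_space show ?thesis
  proof eventually_elim
    case (elim \<omega>)
    show ?case
    proof (intro allI)
      fix t c :: real
      obtain k :: nat where "max t c \<le> real k" using real_arch_simple by blast
      moreover have "{0..real k} \<times> {0..real k} \<in> sets (N3 \<omega>)"
        using elim PRM3 sets_time_mark_intensityI[of "{0..real k} \<times> {0..real k}" "real n * theta"]
        by (fastforce simp: poisson_random_measure_def random_measure_def borel_Times)
      ultimately have "emeasure (N3 \<omega>) ({0..t} \<times> {0..c}) \<le> emeasure (N3 \<omega>) ({0..real k} \<times> {0..real k})"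
        by (intro emeasure_mono) auto
      then show "emeasure (N3 \<omega>) ({0..t} \<times> {0..c}) < \<infinity>" using elim by (meson le_less_trans)
    qed
  qed
qed

lemma AE_queue_path:
  "AE \<omega> in P. queue_path n x (N1 \<omega>) (N2 \<omega>) (N3 \<omega>) (\<lambda>t. X t \<omega>) (\<lambda>t. R t \<omega>)"
proof -
  have "AE \<omega> in P. emeasure (N1 \<omega>) {0} = 0"
    by (rule AE_emeasure_zero_of_null[OF PRM1]) (auto intro!: sets_time_intensityI simp: emeasure_time_intensity)
  moreover have "AE \<omega> in P. emeasure (N2 \<omega>) {0} = 0"
    by (rule AE_emeasure_zero_of_null[OF PRM2]) (auto intro!: sets_time_intensityI simp: emeasure_time_intensity)
  \<comment> \<open>A single time with unbounded marks has intensity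
    \<open>0 * \<infinity> = 0\<close>.\<close>
  moreover have "AE \<omega> in P. emeasure (N3 \<omega>) ({0} \<times> {0..}) = 0"
    by (rule AE_emeasure_zero_of_null[OF PRM3])
       (auto intro!: sets_time_mark_intensityI simp: emeasure_time_mark_intensity borel_Times)
  ultimately show ?thesis
    using AE_space AE_finite_time[OF PRM1] AE_finite_time[OF PRM2] AE_finite_time_mark X_cadlag X_eq R_eq
  proof eventually_elim
    case (elim \<omega>)
    show ?case
      by unfold_locales (use elim n_pos sets_N[of \<omega>] in auto)
  qed
qed

section \<open>Tail bounds for counts, reneging and netput\<close>

definition a :: "'a \<Rightarrow> real \<Rightarrow> real \<Rightarrow> real" where "a \<omega> s t = measure (N1 \<omega>) {s<..t} / real n"
definition b :: "'a \<Rightarrow> real \<Rightarrow> real \<Rightarrow> real" where "b \<omega> s t = measure (N2 \<omega>) {s<..t} / real n"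
definition g :: "'a \<Rightarrow> real \<Rightarrow> real \<Rightarrow> real \<Rightarrow> real" where
  "g \<omega> s t c = measure (N3 \<omega>) ({s<..t} \<times> {0..c}) / real n"

definition netput_plus :: "'a \<Rightarrow> real \<Rightarrow> nat \<Rightarrow> real" where
  "netput_plus \<omega> t m = (\<Sum>i<m. max 0 (a \<omega> (grid t m i) (grid t m (Suc i)) - b \<omega> (grid t m i) (grid t m (Suc i))))"

lemma measurable_counts [measurable]:
  assumes "0 \<le> s"
  shows "(\<lambda>\<omega>. a \<omega> s t) \<in> borel_measurable P" "(\<lambda>\<omega>. b \<omega> s t) \<in> borel_measurable P"
    "(\<lambda>\<omega>. g \<omega> s t c) \<in> borel_measurable P"
proof -
  have "(\<lambda>\<omega>. measure (N1 \<omega>) {s<..t}) \<in> borel_measurable P"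
    using assms by (intro random_measure_measurable_measure[OF PRM_random_measure[OF PRM1]] sets_time_intensityI) auto
  then show "(\<lambda>\<omega>. a \<omega> s t) \<in> borel_measurable P" unfolding a_def by measurable
  have "(\<lambda>\<omega>. measure (N2 \<omega>) {s<..t}) \<in> borel_measurable P"
    using assms by (intro random_measure_measurable_measure[OF PRM_random_measure[OF PRM2]] sets_time_intensityI) auto
  then show "(\<lambda>\<omega>. b \<omega> s t) \<in> borel_measurable P" unfolding b_def by measurable
  have "(\<lambda>\<omega>. measure (N3 \<omega>) ({s<..t} \<times> {0..c})) \<in> borel_measurable P"
    using assms by (intro random_measure_measurable_measure[OF PRM_random_measure[OF PRM3]] sets_time_mark_intensityI)
      (auto simp: borel_Times)
  then show "(\<lambda>\<omega>. g \<omega> s t c) \<in> borel_measurable P" unfolding g_def by measurable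
qed

lemma measurable_netput_plus [measurable]:
  assumes "0 \<le> t"
  shows "(\<lambda>\<omega>. netput_plus \<omega> t m) \<in> borel_measurable P"
  unfolding netput_plus_def using assms by (intro borel_measurable_sum borel_measurable_max) auto

lemma a_tail:
  assumes "0 \<le> s" "s \<le> t" "lam * (t - s) * (exp \<beta> - 1) + K \<le> \<beta> * c" "0 \<le> \<beta>"
  shows "prob {\<omega>\<in>space P. c \<le> a \<omega> s t} \<le> exp (- real n * K)"
proof -
  have "prob {\<omega>\<in>space P. real n * c \<le> measure (N1 \<omega>) {s<..t}} \<le> exp (- real n * K)"
    using assms rates_pos
    by (intro PRM_upper_tail[OF PRM1, of _ n "lam * (t - s)" \<beta>] sets_time_intensityI)
       (auto simp: emeasure_time_intensity_Ioc mult_ac)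
  then show ?thesis using n_pos by (simp add: a_def pos_le_divide_eq mult.commute)
qed

lemma b_tail:
  assumes "0 \<le> s" "s \<le> t" "mu * (t - s) * (exp \<beta> - 1) + K \<le> \<beta> * c" "0 \<le> \<beta>"
  shows "prob {\<omega>\<in>space P. c \<le> b \<omega> s t} \<le> exp (- real n * K)"
proof -
  have "prob {\<omega>\<in>space P. real n * c \<le> measure (N2 \<omega>) {s<..t}} \<le> exp (- real n * K)"
    using assms rates_pos
    by (intro PRM_upper_tail[OF PRM2, of _ n "mu * (t - s)" \<beta>] sets_time_intensityI)
       (auto simp: emeasure_time_intensity_Ioc mult_ac)
  then show ?thesis using n_pos by (simp add: b_def pos_le_divide_eq mult.commute)
qed

lemma g_tail:
  assumes "0 \<le> s" "s \<le> t" "0 \<le> y" "theta * (t - s) * y * (exp \<beta> - 1) + K \<le> \<beta> * c" "0 \<le> \<beta>"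
  shows "prob {\<omega>\<in>space P. c \<le> g \<omega> s t y} \<le> exp (- real n * K)"
proof -
  have "prob {\<omega>\<in>space P. real n * c \<le> measure (N3 \<omega>) ({s<..t} \<times> {0..y})} \<le> exp (- real n * K)"
    using assms rates_pos
    by (intro PRM_upper_tail[OF PRM3, of _ n "theta * (t - s) * y" \<beta>] sets_time_mark_intensityI)
       (auto simp: emeasure_time_mark_intensity_box borel_Times mult_ac)
  then show ?thesis using n_pos by (simp add: g_def pos_le_divide_eq mult.commute)
qed

lemma g_lower_tail:
  assumes "0 \<le> s" "s \<le> t" "0 \<le> y" "c + K \<le> theta * (t - s) * y * (1 - exp (- 1))"
  shows "prob {\<omega>\<in>space P. g \<omega> s t y \<le> c} \<le> exp (- real n * K)"
proof -
  have "prob {\<omega>\<in>space P. measure (N3 \<omega>) ({s<..t} \<times> {0..y}) \<le> real n * c} \<le> exp (- real n * K)"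
    using assms rates_pos
    by (intro PRM_lower_tail[OF PRM3, of _ n "theta * (t - s) * y"] sets_time_mark_intensityI)
       (auto simp: emeasure_time_mark_intensity_box borel_Times mult_ac)
  then show ?thesis using n_pos by (simp add: g_def pos_divide_le_eq mult.commute)
qed

text \<open>A union bound over the ways in which the hypotheses or error terms of
  \<open>queue_path.R_grid_bound\<close> can fail to be controlled: four totals over
  \<open>(0, t]\<close> and three counts in each of the \<open>m\<close> cells. The bound
  \<open>QA\<close> on arrivals also caps the queue and thereby fixes the mark height
  \<open>M\<close>.\<close>

lemma grid_bound_prob:
  assumes t: "0 < t" and m: "0 < m" and \<delta>: "0 < \<delta>" "\<delta> \<le> \<kappa>" and M: "x + QA \<le> M" "0 \<le> QA"
    and Q: "lam * t * (exp 1 - 1) + K \<le> QA" "mu * t * (exp 1 - 1) + K \<le> QB"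
      "theta * t * M * (exp 1 - 1) + K \<le> QG"
    and \<eta>: "theta * t * (2 * \<kappa>) * (exp \<beta>' - 1) + K \<le> \<beta>' * \<eta>" "0 \<le> \<beta>'"
    and \<beta>: "lam * (t / real m) * (exp \<beta> - 1) + K \<le> \<beta> * \<delta>" "mu * (t / real m) * (exp \<beta> - 1) + K \<le> \<beta> * \<delta>"
      "theta * (t / real m) * M * (exp \<beta> - 1) + K \<le> \<beta> * \<delta>" "0 \<le> \<beta>"
  shows "prob {\<omega>\<in>space P. x + netput_plus \<omega> t m + \<eta> + 6 * \<delta> / \<kappa> * (QA + QB + QG) < R t \<omega>}
    \<le> (4 + 3 * real m) * exp (- real n * K)"
proof -
  let ?s = "grid t m"
  define E where "E = {\<omega>\<in>space P. QA \<le> a \<omega> 0 t} \<union> {\<omega>\<in>space P. QB \<le> b \<omega> 0 t} \<union>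
    {\<omega>\<in>space P. QG \<le> g \<omega> 0 t M} \<union> {\<omega>\<in>space P. \<eta> \<le> g \<omega> 0 t (2 * \<kappa>)}"
  define F where "F i = {\<omega>\<in>space P. \<delta> \<le> a \<omega> (?s i) (?s (Suc i))} \<union> {\<omega>\<in>space P. \<delta> \<le> b \<omega> (?s i) (?s (Suc i))} \<union>
    {\<omega>\<in>space P. \<delta> \<le> g \<omega> (?s i) (?s (Suc i)) M}" for i
  have \<kappa>: "0 < \<kappa>" using \<delta> by simp
  have M0: "0 \<le> M" using M x_nonneg by simp
  have s: "0 \<le> ?s i" "?s i \<le> ?s (Suc i)" "?s (Suc i) - ?s i = t / real m" for i
    using t by (auto intro: grid_mono simp: grid_Suc)
  have [measurable]: "E \<in> events" unfolding E_def by (intro sets.Un) measurable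
  have [measurable]: "F i \<in> events" for i unfolding F_def using s(1) by (intro sets.Un) measurable
  have "prob {\<omega>\<in>space P. x + netput_plus \<omega> t m + \<eta> + 6 * \<delta> / \<kappa> * (QA + QB + QG) < R t \<omega>}
      \<le> prob (E \<union> (\<Union>i<m. F i))"
  proof (rule finite_measure_mono_AE)
    from AE_queue_path
    show "AE \<omega> in P. \<omega> \<in> {\<omega>\<in>space P. x + netput_plus \<omega> t m + \<eta> + 6 * \<delta> / \<kappa> * (QA + QB + QG) < R t \<omega>}
        \<longrightarrow> \<omega> \<in> E \<union> (\<Union>i<m. F i)"
    proof eventually_elim
      case (elim \<omega>)
      interpret q: queue_path n x "N1 \<omega>" "N2 \<omega>" "N3 \<omega>" "\<lambda>t. X t \<omega>" "\<lambda>t. R t \<omega>" by fact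
      have eq: "q.a = a \<omega>" "q.b = b \<omega>" "q.g = g \<omega>"
        by (simp_all add: fun_eq_iff q.a_def a_def q.b_def b_def q.g_def g_def)
      show ?case
      proof (rule impI, rule ccontr)
        assume \<omega>: "\<omega> \<in> {\<omega>\<in>space P. x + netput_plus \<omega> t m + \<eta> + 6 * \<delta> / \<kappa> * (QA + QB + QG) < R t \<omega>}"
          and nE: "\<omega> \<notin> E \<union> (\<Union>i<m. F i)"
        have E: "a \<omega> 0 t < QA" "b \<omega> 0 t < QB" "g \<omega> 0 t M < QG" "g \<omega> 0 t (2 * \<kappa>) < \<eta>"
          using nE \<omega> by (auto simp: E_def)
        have F: "a \<omega> (?s i) (?s (Suc i)) \<le> \<delta>" "b \<omega> (?s i) (?s (Suc i)) \<le> \<delta>"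
           "g \<omega> (?s i) (?s (Suc i)) M \<le> \<delta>" if "i < m" for i
          using nE \<omega> that by (force simp: F_def)+
        have "R t \<omega> \<le> x + netput_plus \<omega> t m + g \<omega> 0 t (2 * \<kappa>) + 6 * \<delta> / \<kappa> * (a \<omega> 0 t + b \<omega> 0 t + g \<omega> 0 t M)"
          using q.R_grid_bound[OF t m \<kappa> x_nonneg, of M \<delta>] E F M \<delta> by (simp add: eq netput_plus_def)
        moreover have "6 * \<delta> / \<kappa> * (a \<omega> 0 t + b \<omega> 0 t + g \<omega> 0 t M) \<le> 6 * \<delta> / \<kappa> * (QA + QB + QG)"
          using E \<delta> \<kappa> by (intro mult_left_mono) auto
        ultimately show False using \<omega> E by simp
      qed
    qed
  qed measurable
  also have "\<dots> \<le> prob E + (\<Sum>i<m. prob (F i))"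
    by (intro order_trans[OF measure_Un_le] add_left_mono finite_measure_subadditive_finite) auto
  also have "prob E \<le> exp (- real n * K) + exp (- real n * K) + exp (- real n * K) + exp (- real n * K)"
  proof -
    have 1: "prob {\<omega>\<in>space P. QA \<le> a \<omega> 0 t} \<le> exp (- real n * K)"
      by (rule a_tail[where \<beta>=1]) (use t Q in auto)
    have 2: "prob {\<omega>\<in>space P. QB \<le> b \<omega> 0 t} \<le> exp (- real n * K)"
      by (rule b_tail[where \<beta>=1]) (use t Q in auto)
    have 3: "prob {\<omega>\<in>space P. QG \<le> g \<omega> 0 t M} \<le> exp (- real n * K)"
      by (rule g_tail[where \<beta>=1]) (use t M0 Q in auto)
    have 4: "prob {\<omega>\<in>space P. \<eta> \<le> g \<omega> 0 t (2 * \<kappa>)} \<le> exp (- real n * K)"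
      by (rule g_tail[where \<beta>=\<beta>']) (use t \<kappa> \<eta> in auto)
    show ?thesis
      unfolding E_def
      by (intro order_trans[OF measure_Un_le] add_mono 1 2 3 4 sets.Un) measurable
  qed
  also have "(\<Sum>i<m. prob (F i)) \<le> (\<Sum>i<m. exp (- real n * K) + exp (- real n * K) + exp (- real n * K))"
  proof (rule sum_mono)
    fix i
    have 1: "prob {\<omega>\<in>space P. \<delta> \<le> a \<omega> (?s i) (?s (Suc i))} \<le> exp (- real n * K)"
      by (rule a_tail[where \<beta>=\<beta>]) (use s[of i] \<beta> in auto)
    have 2: "prob {\<omega>\<in>space P. \<delta> \<le> b \<omega> (?s i) (?s (Suc i))} \<le> exp (- real n * K)"
      by (rule b_tail[where \<beta>=\<beta>]) (use s[of i] \<beta> in auto)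
    have 3: "prob {\<omega>\<in>space P. \<delta> \<le> g \<omega> (?s i) (?s (Suc i)) M} \<le> exp (- real n * K)"
      by (rule g_tail[where \<beta>=\<beta>]) (use s[of i] M0 \<beta> in auto)
    show "prob (F i) \<le> exp (- real n * K) + exp (- real n * K) + exp (- real n * K)"
      unfolding F_def using s(1)[of i]
      by (intro order_trans[OF measure_Un_le] add_mono 1 2 3 sets.Un) measurable
  qed
  finally show ?thesis by (simp add: algebra_simps)
qed

lemma window_prob:
  assumes y: "4 / real n \<le> y" and c: "0 \<le> c" "c \<le> t"
    and \<beta>: "lam * c * (exp \<beta> - 1) + K \<le> \<beta> * (y / 2)" "0 \<le> \<beta>"
    and v: "v + K \<le> theta * c * (y / 4) * (1 - exp (- 1))"
  shows "prob {\<omega>\<in>space P. y \<le> X t \<omega> \<and> R t \<omega> \<le> v} \<le> 2 * exp (- real n * K)"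
proof -
  have y0: "0 \<le> y" using y n_pos by (smt (verit) divide_nonneg_nonneg of_nat_0_le_iff)
  have "prob {\<omega>\<in>space P. y \<le> X t \<omega> \<and> R t \<omega> \<le> v} \<le>
      prob ({\<omega>\<in>space P. y / 2 \<le> a \<omega> (t - c) t} \<union> {\<omega>\<in>space P. g \<omega> (t - c) t (y / 4) \<le> v})"
  proof (rule finite_measure_mono_AE)
    from AE_queue_path
    show "AE \<omega> in P. \<omega> \<in> {\<omega>\<in>space P. y \<le> X t \<omega> \<and> R t \<omega> \<le> v} \<longrightarrow>
        \<omega> \<in> {\<omega>\<in>space P. y / 2 \<le> a \<omega> (t - c) t} \<union> {\<omega>\<in>space P. g \<omega> (t - c) t (y / 4) \<le> v}"
    proof eventually_elim
      case (elim \<omega>)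
      interpret q: queue_path n x "N1 \<omega>" "N2 \<omega>" "N3 \<omega>" "\<lambda>t. X t \<omega>" "\<lambda>t. R t \<omega>" by fact
      have eq: "q.a = a \<omega>" "q.g = g \<omega>"
        by (simp_all add: fun_eq_iff q.a_def a_def q.g_def g_def)
      \<comment> \<open>The level \<open>y\<close> is spent as \<open>y / 2\<close> on arrivals in
        the window, \<open>y / 4\<close> on the customer in service and \<open>y / 4\<close> on the
        marks that must count.\<close>
      have "1 / real n \<le> y / 4" using y by simp
      then have "y / 4 + 1 / real n \<le> X t \<omega> - a \<omega> (t - c) t"
        if "y \<le> X t \<omega>" "a \<omega> (t - c) t < y / 2" using that by linarith
      then show ?case using q.R_ge_window[OF c, of "y / 4"] unfolding eq by force
    qed
    show "{\<omega>\<in>space P. y / 2 \<le> a \<omega> (t - c) t} \<union> {\<omega>\<in>space P. g \<omega> (t - c) t (y / 4) \<le> v} \<in> events"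
      using c by (intro sets.Un) measurable
  qed
  also have "\<dots> \<le> exp (- real n * K) + exp (- real n * K)"
  proof -
    have 1: "prob {\<omega>\<in>space P. y / 2 \<le> a \<omega> (t - c) t} \<le> exp (- real n * K)"
      by (rule a_tail[where \<beta>=\<beta>]) (use c \<beta> in auto)
    have 2: "prob {\<omega>\<in>space P. g \<omega> (t - c) t (y / 4) \<le> v} \<le> exp (- real n * K)"
      by (rule g_lower_tail) (use c v y0 in auto)
    show ?thesis
      using c by (intro order_trans[OF measure_Un_le] add_mono 1 2) measurable
  qed
  finally show ?thesis by simp
qed

lemma AE_X_plus_R_ge:
  assumes "0 \<le> t"
  shows "AE \<omega> in P. x + a \<omega> 0 t - b \<omega> 0 t \<le> X t \<omega> + R t \<omega>"
  using AE_queue_path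
proof eventually_elim
  case (elim \<omega>)
  interpret q: queue_path n x "N1 \<omega>" "N2 \<omega>" "N3 \<omega>" "\<lambda>t. X t \<omega>" "\<lambda>t. R t \<omega>" by fact
  show ?case using q.X_plus_R_ge[OF assms] by (simp add: q.a_def a_def q.b_def b_def)
qed

lemma indep_N1_N2:
  assumes "F1 \<in> random_measure_events P (time_intensity (real n * lam)) N1"
    "F2 \<in> random_measure_events P (time_intensity (real n * mu)) N2"
  shows "prob (F1 \<inter> F2) = prob F1 * prob F2"
  using indep_setsD[OF indep_PRMs, of "{0,1}" "\<lambda>i. if i = 0 then F1 else F2"] assms
  by (simp add: Int_commute)

lemma netput_chernoff:
  assumes B: "B \<in> sets borel" "B \<subseteq> {0..}" "emeasure lborel B = ennreal l" "0 \<le> l"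
  shows "prob {\<omega>\<in>space P. c \<le> \<beta>1 * measure (N1 \<omega>) B + \<beta>2 * measure (N2 \<omega>) B}
    \<le> exp (real n * l * (lam * (exp \<beta>1 - 1) + mu * (exp \<beta>2 - 1)) - c)"
proof -
  have e: "emeasure (time_intensity (real n * r)) B = ennreal (real n * r * l)" if "0 < r" for r
    using that B by (simp add: emeasure_time_intensity flip: ennreal_mult)
  then have "measure (time_intensity (real n * r)) B = real n * r * l" if "0 < r" for r
    using that B by (simp add: measure_def)
  then show ?thesis
    using PRM_chernoff_pair[OF PRM1 PRM2 indep_N1_N2 sets_time_intensityI[OF B(1,2)] sets_time_intensityI[OF B(1,2)],
        of c \<beta>1 \<beta>2] e rates_pos
    by (simp add: algebra_simps)
qed

text \<open>A sum of positive parts is the largest of its \<open>2 ^ m\<close> partial sums, so a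
  union bound reduces the tail to netputs over unions of cells. By \<open>H\<close>, a union of
  length less than \<open>t\<close> has no larger exponential moment than the full interval.\<close>

lemma netput_plus_tail:
  assumes t: "0 < t" and m: "0 < m" and \<alpha>: "0 \<le> \<alpha>" and H: "0 \<le> lam * (exp \<alpha> - 1) + mu * (exp (- \<alpha>) - 1)"
  shows "prob {\<omega>\<in>space P. v \<le> netput_plus \<omega> t m} \<le>
    2 ^ m * exp (- real n * (\<alpha> * v - t * (lam * (exp \<alpha> - 1) + mu * (exp (- \<alpha>) - 1))))"
proof -
  let ?B = "grid_cells t m" and ?h = "lam * (exp \<alpha> - 1) + mu * (exp (- \<alpha>) - 1)"
  define E where "E J = {\<omega>\<in>space P. real n * (\<alpha> * v) \<le> \<alpha> * measure (N1 \<omega>) (?B J) + (- \<alpha>) * measure (N2 \<omega>) (?B J)}" for J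
  have B: "?B J \<in> sets borel" "?B J \<subseteq> {0..}" if "J \<subseteq> {..<m}" for J
  proof -
    show "?B J \<in> sets borel" using that finite_subset unfolding grid_cells_def by (intro sets.finite_UN) auto
    have "0 \<le> u" if "grid t m i < u" for u i using grid_nonneg[of t m i] that t by linarith
    then show "?B J \<subseteq> {0..}" by (auto simp: grid_cells_def)
  qed
  have [measurable]: "E J \<in> events" if "J \<subseteq> {..<m}" for J
  proof -
    have [measurable]: "(\<lambda>\<omega>. measure (N1 \<omega>) (?B J)) \<in> borel_measurable P"
      "(\<lambda>\<omega>. measure (N2 \<omega>) (?B J)) \<in> borel_measurable P"
      using B[OF that] by (intro random_measure_measurable_measure[OF PRM_random_measure[OF PRM1]]
        random_measure_measurable_measure[OF PRM_random_measure[OF PRM2]] sets_time_intensityI; simp)+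
    show ?thesis unfolding E_def by measurable
  qed
  have "prob {\<omega>\<in>space P. v \<le> netput_plus \<omega> t m} \<le> prob (\<Union>J\<in>Pow {..<m}. E J)"
  proof (rule finite_measure_mono_AE)
    from AE_queue_path
    show "AE \<omega> in P. \<omega> \<in> {\<omega>\<in>space P. v \<le> netput_plus \<omega> t m} \<longrightarrow> \<omega> \<in> (\<Union>J\<in>Pow {..<m}. E J)"
    proof eventually_elim
      case (elim \<omega>)
      interpret q: queue_path n x "N1 \<omega>" "N2 \<omega>" "N3 \<omega>" "\<lambda>t. X t \<omega>" "\<lambda>t. R t \<omega>" by fact
      let ?I = "\<lambda>i. {grid t m i<..grid t m (Suc i)}"
      \<comment> \<open>The cells of nonnegative netput, the maximising subset for this
        path.\<close>
      define J where "J = {i\<in>{..<m}. b \<omega> (grid t m i) (grid t m (Suc i)) \<le> a \<omega> (grid t m i) (grid t m (Suc i))}"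
      have J: "J \<subseteq> {..<m}" "finite J" by (auto simp: J_def)
      have I: "?I i \<subseteq> {0..grid t m (Suc i)}" for i using grid_nonneg[of t m i] t by (auto simp del: grid_nonneg)
      have dj: "disjoint_family_on ?I J"
        using disjoint_grid_cells[of t m] t by (auto simp: disjoint_family_on_def)
      have m1: "measure (N1 \<omega>) (?B J) = (\<Sum>i\<in>J. measure (N1 \<omega>) (?I i))"
        unfolding grid_cells_def
        using I J dj q.finite_A_subset[OF I] q.sets_A_I[of "?I _"] by (intro measure_finite_Union) fastforce+
      have m2: "measure (N2 \<omega>) (?B J) = (\<Sum>i\<in>J. measure (N2 \<omega>) (?I i))"
        unfolding grid_cells_def
        using I J dj q.finite_S_subset[OF I] q.sets_S_I[of "?I _"] by (intro measure_finite_Union) fastforce+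
      have "netput_plus \<omega> t m = (\<Sum>i\<in>J. a \<omega> (grid t m i) (grid t m (Suc i)) - b \<omega> (grid t m i) (grid t m (Suc i)))"
        unfolding netput_plus_def J_def by (subst sum.inter_filter) (auto intro!: sum.cong)
      also have "\<dots> = (measure (N1 \<omega>) (?B J) - measure (N2 \<omega>) (?B J)) / real n"
        unfolding m1 m2 a_def b_def by (simp add: sum_subtractf diff_divide_distrib sum_divide_distrib)
      finally have "real n * netput_plus \<omega> t m = measure (N1 \<omega>) (?B J) - measure (N2 \<omega>) (?B J)"
        using n_pos by simp
      moreover have "\<alpha> * (real n * v) \<le> \<alpha> * (real n * netput_plus \<omega> t m)" if "v \<le> netput_plus \<omega> t m"
        using that \<alpha> by (intro mult_left_mono) auto
      ultimately have "\<omega> \<in> E J" if "\<omega> \<in> {\<omega>\<in>space P. v \<le> netput_plus \<omega> t m}"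
        using that unfolding E_def by (simp only: mem_Collect_eq) (simp add: algebra_simps)
      then show ?case using J by blast
    qed
  qed auto
  also have "\<dots> \<le> (\<Sum>J\<in>Pow {..<m}. prob (E J))"
    by (intro finite_measure_subadditive_finite) auto
  also have "\<dots> \<le> (\<Sum>J\<in>Pow {..<m}. exp (- real n * (\<alpha> * v - t * ?h)))"
  proof (rule sum_mono)
    fix J assume "J \<in> Pow {..<m}"
    then have J: "J \<subseteq> {..<m}" "finite J" "card J \<le> m"
      using finite_subset card_mono[of "{..<m}" J] by auto
    have l: "real (card J) * (t / real m) \<le> t"
      using J m t mult_right_mono[of "real (card J)" "real m" t] by (simp add: field_simps)
    have "prob (E J) \<le> exp (real n * (real (card J) * (t / real m)) * ?h - real n * (\<alpha> * v))"
      unfolding E_def using J B[OF J(1)] t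
      by (intro netput_chernoff) (auto simp: emeasure_grid_cells)
    also have "\<dots> \<le> exp (real n * t * ?h - real n * (\<alpha> * v))"
      using l H by (intro exp_mono diff_right_mono mult_right_mono mult_left_mono) auto
    also have "\<dots> = exp (- real n * (\<alpha> * v - t * ?h))" by (simp add: algebra_simps)
    finally show "prob (E J) \<le> exp (- real n * (\<alpha> * v - t * ?h))" .
  qed
  also have "\<dots> = 2 ^ m * exp (- real n * (\<alpha> * v - t * ?h))" by (simp add: card_Pow)
  finally show ?thesis .
qed

lemma netput_lower_tail:
  assumes t: "0 \<le> t" and \<beta>: "0 \<le> \<beta>"
  shows "prob {\<omega>\<in>space P. a \<omega> 0 t - b \<omega> 0 t \<le> v} \<le>
    exp (real n * (\<beta> * v + t * (lam * (exp (- \<beta>) - 1) + mu * (exp \<beta> - 1))))"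
proof -
  have [measurable]: "(\<lambda>\<omega>. measure (N1 \<omega>) {0<..t}) \<in> borel_measurable P"
    "(\<lambda>\<omega>. measure (N2 \<omega>) {0<..t}) \<in> borel_measurable P"
    by (intro random_measure_measurable_measure[OF PRM_random_measure[OF PRM1]]
        random_measure_measurable_measure[OF PRM_random_measure[OF PRM2]] sets_time_intensityI; auto)+
  have "prob {\<omega>\<in>space P. a \<omega> 0 t - b \<omega> 0 t \<le> v} \<le>
      prob {\<omega>\<in>space P. - (\<beta> * (real n * v)) \<le> (- \<beta>) * measure (N1 \<omega>) {0<..t} + \<beta> * measure (N2 \<omega>) {0<..t}}"
  proof (rule finite_measure_mono)
    have "- (\<beta> * (real n * v)) \<le> (- \<beta>) * measure (N1 \<omega>) {0<..t} + \<beta> * measure (N2 \<omega>) {0<..t}"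
      if "a \<omega> 0 t - b \<omega> 0 t \<le> v" for \<omega>
    proof -
      have "measure (N1 \<omega>) {0<..t} - measure (N2 \<omega>) {0<..t} \<le> real n * v"
        using that n_pos by (simp add: a_def b_def pos_divide_le_eq mult.commute flip: diff_divide_distrib)
      then have "\<beta> * (measure (N1 \<omega>) {0<..t} - measure (N2 \<omega>) {0<..t}) \<le> \<beta> * (real n * v)"
        using \<beta> by (intro mult_left_mono)
      then show ?thesis by (simp add: algebra_simps)
    qed
    then show "{\<omega>\<in>space P. a \<omega> 0 t - b \<omega> 0 t \<le> v} \<subseteq>
      {\<omega>\<in>space P. - (\<beta> * (real n * v)) \<le> (- \<beta>) * measure (N1 \<omega>) {0<..t} + \<beta> * measure (N2 \<omega>) {0<..t}}"
      by auto
  qed measurable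
  also have "\<dots> \<le> exp (real n * t * (lam * (exp (- \<beta>) - 1) + mu * (exp \<beta> - 1)) - (- (\<beta> * (real n * v))))"
    using t by (intro netput_chernoff) auto
  finally show ?thesis by (simp add: algebra_simps)
qed

text \<open>Independence of \<open>N1\<close> and \<open>N2\<close> is a statement about their
  generated sigma-algebras, so membership there is required and not only measurability.\<close>

lemma grid_counts_event:
  assumes "\<And>i. i < (m::nat) \<Longrightarrow> B i \<in> sets E"
  shows "{\<omega>\<in>space P. \<forall>i<m. emeasure (N \<omega>) (B i) = of_nat j} \<in> random_measure_events P E N"
proof -
  interpret sigma_algebra "space P" "random_measure_events P E N"
    unfolding random_measure_events_def by (rule sigma_algebra_sigma_sets) auto
  have "{\<omega>\<in>space P. emeasure (N \<omega>) (B i) = of_nat j} \<in> random_measure_events P E N" if "i \<in> {..<m}" for i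
  proof -
    have "(\<lambda>\<omega>. emeasure (N \<omega>) (B i)) -` {of_nat j} \<inter> space P \<in> random_measure_events P E N"
      unfolding random_measure_events_def
    proof (rule sigma_sets.Basic, intro CollectI exI conjI)
      show "B i \<in> sets E" using assms that by simp
      show "{of_nat j} \<in> sets (borel :: ennreal measure)" by simp
    qed (rule refl)
    also have "(\<lambda>\<omega>. emeasure (N \<omega>) (B i)) -` {of_nat j} \<inter> space P = {\<omega>\<in>space P. emeasure (N \<omega>) (B i) = of_nat j}"
      by blast
    finally show ?thesis .
  qed
  then have "{\<omega>\<in>space P. \<forall>i\<in>{..<m}. emeasure (N \<omega>) (B i) = of_nat j} \<in> random_measure_events P E N"
    by (intro sets_Collect_finite_All) auto
  then show ?thesis by (simp add: Ball_def)
qed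

lemma grid_counts_prob:
  assumes t: "0 < t" and m: "0 < m"
  shows "prob {\<omega>\<in>space P. \<forall>i<m. emeasure (N1 \<omega>) {grid t m i<..grid t m (Suc i)} = of_nat j \<and>
      emeasure (N2 \<omega>) {grid t m i<..grid t m (Suc i)} = of_nat l} =
    ((real n * (lam * t / real m)) ^ j / fact j * exp (- (real n * (lam * t / real m)))) ^ m *
    ((real n * (mu * t / real m)) ^ l / fact l * exp (- (real n * (mu * t / real m)))) ^ m"
proof -
  let ?I = "\<lambda>i. {grid t m i<..grid t m (Suc i)}"
  have I: "?I i \<in> sets (time_intensity r)" for i r
    using t grid_nonneg[of t m i] by (intro sets_time_intensityI) (auto simp del: grid_nonneg)
  have e: "emeasure (time_intensity (real n * r)) (?I i) = ennreal (real n * (r * t / real m))" if "0 < r" for i r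
    using t that by (subst emeasure_time_intensity_Ioc) (auto intro: grid_mono simp: grid_Suc)
  then have me: "measure (time_intensity (real n * r)) (?I i) = real n * (r * t / real m)" if "0 < r" for i r
    using that t by (simp add: measure_def)
  have dj: "disjoint_family_on ?I {..<m}"
    using disjoint_grid_cells[of t m] t by (auto simp: disjoint_family_on_def)
  define F1 where "F1 = {\<omega>\<in>space P. \<forall>i<m. emeasure (N1 \<omega>) (?I i) = of_nat j}"
  define F2 where "F2 = {\<omega>\<in>space P. \<forall>i<m. emeasure (N2 \<omega>) (?I i) = of_nat l}"
  have "prob (F1 \<inter> F2) = prob F1 * prob F2"
    unfolding F1_def F2_def by (intro indep_N1_N2 grid_counts_event I)
  moreover have "F1 \<inter> F2 = {\<omega>\<in>space P. \<forall>i<m. emeasure (N1 \<omega>) (?I i) = of_nat j \<and> emeasure (N2 \<omega>) (?I i) = of_nat l}"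
    by (auto simp: F1_def F2_def)
  moreover have "prob F1 = ((real n * (lam * t / real m)) ^ j / fact j * exp (- (real n * (lam * t / real m)))) ^ m"
    unfolding F1_def using rates_pos e[OF rates_pos(1)]
    by (subst PRM_product_point[OF PRM1 I dj m]) (simp add: PRM_point[OF PRM1 I] me)
  moreover have "prob F2 = ((real n * (mu * t / real m)) ^ l / fact l * exp (- (real n * (mu * t / real m)))) ^ m"
    unfolding F2_def using rates_pos e[OF rates_pos(2)]
    by (subst PRM_product_point[OF PRM2 I dj m]) (simp add: PRM_point[OF PRM2 I] me)
  ultimately show ?thesis by simp
qed

end

section \<open>The decay rate and logarithmic limits\<close>

text \<open>The logarithmic moment generating function at \<alpha> of the difference of independent
  Poisson variables with means \<open>lam\<close> and \<open>mu\<close>.\<close>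

definition log_mgf :: "real \<Rightarrow> real \<Rightarrow> real \<Rightarrow> real" where
  "log_mgf lam mu \<alpha> = lam * (exp \<alpha> - 1) + mu * (exp (- \<alpha>) - 1)"

text \<open>For equal rates the value is \<open>mu\<close> times a square, and a larger
  \<open>lam\<close> adds a nonnegative term. Critical or overloaded traffic enters here.\<close>

lemma log_mgf_nonneg:
  assumes "0 < mu" "mu \<le> lam" "0 \<le> \<alpha>"
  shows "0 \<le> log_mgf lam mu \<alpha>"
proof -
  have "mu * (exp \<alpha> - 1) \<le> lam * (exp \<alpha> - 1)" using assms by (intro mult_right_mono) auto
  moreover have "mu * (exp \<alpha> - 1) + mu * (exp (- \<alpha>) - 1) = mu * (exp (\<alpha> / 2) - exp (- \<alpha> / 2))\<^sup>2"
    by (simp add: power2_diff algebra_simps flip: exp_double exp_add)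
  moreover have "0 \<le> mu * (exp (\<alpha> / 2) - exp (- \<alpha> / 2))\<^sup>2" using assms by simp
  ultimately show ?thesis unfolding log_mgf_def by linarith
qed

section \<open>The optimal tilt and the decay rate\<close>

context
  fixes lam mu :: real
  assumes lam: "0 < lam" and mu: "0 < mu"
begin

lemma z_root_pos: "0 < z_root lam mu \<gamma>"
proof -
  have "\<bar>\<gamma>\<bar> < sqrt (\<gamma>\<^sup>2 + 4 * lam * mu)"
    using lam mu by (intro real_less_rsqrt) simp
  then show ?thesis using mu by (simp add: z_root_def)
qed

lemma z_root_eq: "mu * (z_root lam mu \<gamma>)\<^sup>2 + \<gamma> * z_root lam mu \<gamma> = lam"
proof -
  define s where "s = sqrt (\<gamma>\<^sup>2 + 4 * lam * mu)"
  have s: "s\<^sup>2 = \<gamma>\<^sup>2 + 4 * lam * mu" using lam mu by (simp add: s_def)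
  have "mu * ((s - \<gamma>) / (2 * mu))\<^sup>2 + \<gamma> * ((s - \<gamma>) / (2 * mu)) = (s\<^sup>2 - \<gamma>\<^sup>2) / (4 * mu)"
    using mu by (simp add: field_simps power2_eq_square)
  also have "\<dots> = lam" using mu by (simp add: s)
  finally show ?thesis by (simp add: z_root_def s_def)
qed

text \<open>The tilted rates \<open>lam / z\<close> and \<open>mu * z\<close> have drift \<gamma>;
  equivalently, \<open>- ln z\<close> is the critical point of
  \<open>\<alpha> * \<gamma> - log_mgf lam mu \<alpha>\<close>.\<close>

lemma z_root_difference: "lam / z_root lam mu \<gamma> - mu * z_root lam mu \<gamma> = \<gamma>"
  using z_root_eq[of \<gamma>] z_root_pos[of \<gamma>] by (simp add: field_simps power2_eq_square)

text \<open>\<open>lam / z - mu * z\<close> decreases in \<open>z\<close> and equals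
  \<open>lam - mu\<close> at 1. The position of \<open>z\<close> relative to 1 is the sign of the
  tilt \<open>- ln z\<close>, which decides the tail that Chernoff's bound controls.\<close>

lemma z_root_less_1: "lam - mu < \<gamma> \<Longrightarrow> z_root lam mu \<gamma> < 1"
proof (rule ccontr)
  assume \<gamma>: "lam - mu < \<gamma>" and "\<not> z_root lam mu \<gamma> < 1"
  then have "1 \<le> z_root lam mu \<gamma>" by simp
  then have "lam / z_root lam mu \<gamma> \<le> lam / 1" "mu * 1 \<le> mu * z_root lam mu \<gamma>"
    using lam mu by (intro divide_left_mono mult_left_mono; simp)+
  then show False using z_root_difference[of \<gamma>] \<gamma> by simp
qed

lemma z_root_greater_1: "\<gamma> < lam - mu \<Longrightarrow> 1 < z_root lam mu \<gamma>"
proof (rule ccontr)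
  assume \<gamma>: "\<gamma> < lam - mu" and "\<not> 1 < z_root lam mu \<gamma>"
  then have "z_root lam mu \<gamma> \<le> 1" by simp
  then have "lam / 1 \<le> lam / z_root lam mu \<gamma>" "mu * z_root lam mu \<gamma> \<le> mu * 1"
    using lam mu z_root_pos[of \<gamma>] by (intro divide_left_mono mult_left_mono; simp)+
  then show False using z_root_difference[of \<gamma>] \<gamma> by simp
qed

text \<open>The decay rate is the Legendre transform of \<^const>\<open>log_mgf\<close>, attained at \<open>- ln z\<close>.\<close>

lemma decay_rate_legendre:
  "decay_rate lam mu \<gamma> = - ln (z_root lam mu \<gamma>) * \<gamma> - log_mgf lam mu (- ln (z_root lam mu \<gamma>))"
  using z_root_pos[of \<gamma>] by (simp add: decay_rate_def log_mgf_def exp_minus algebra_simps)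

text \<open>Running arrivals at rate \<open>a\<close> and services at rate \<open>b\<close> costs
  the sum of two Poisson relative entropies per unit time. Its agreement with the Legendre transform
  makes the lower estimates match the upper ones.\<close>

lemma decay_rate_entropy:
  fixes \<gamma> :: real
  defines "a \<equiv> lam / z_root lam mu \<gamma>" and "b \<equiv> mu * z_root lam mu \<gamma>"
  shows "(lam - a + a * ln (a / lam)) + (mu - b + b * ln (b / mu)) = decay_rate lam mu \<gamma>"
proof -
  define z where "z = z_root lam mu \<gamma>"
  have z: "0 < z" using z_root_pos by (simp add: z_def)
  have "ln (a / lam) = - ln z" "ln (b / mu) = ln z"
    using lam mu z by (simp_all add: a_def b_def z_def[symmetric] ln_div)
  then have "(lam - a + a * ln (a / lam)) + (mu - b + b * ln (b / mu)) = lam - a + mu - b - (a - b) * ln z"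
    by (simp add: algebra_simps)
  also have "a - b = \<gamma>" using z_root_difference by (simp add: a_def b_def)
  finally show ?thesis
    by (simp add: decay_rate_def a_def b_def z_def divide_inverse algebra_simps)
qed

lemma isCont_decay_rate: "isCont (decay_rate lam mu) \<gamma>"
proof -
  have "isCont (z_root lam mu) \<gamma>"
    unfolding z_root_def[abs_def] using mu by (intro continuous_intros) auto
  then show ?thesis
    unfolding decay_rate_def[abs_def]
    by (intro continuous_intros) (use z_root_pos[of \<gamma>] in auto)
qed

end

text \<open>Prefactors such as \<open>2 ^ m\<close> depend on \<open>t\<close> through the mesh but
  not on \<open>n\<close>, so an arbitrarily small loss of rate removes them.\<close>

lemma eventually_exp_absorb:
  fixes D u v :: real
  assumes "v < u"
  shows "\<forall>\<^sub>F n in sequentially. D * exp (- real n * u) \<le> exp (- real n * v)"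
proof -
  have "((\<lambda>n. D * exp (- real n * (u - v))) \<longlongrightarrow> 0) sequentially"
    using assms by real_asymp
  then have "\<forall>\<^sub>F n in sequentially. D * exp (- real n * (u - v)) < 1"
    by (rule order_tendstoD) simp
  then show ?thesis
  proof eventually_elim
    case (elim n)
    have "exp (- real n * u) = exp (- real n * (u - v)) * exp (- real n * v)"
      unfolding exp_add[symmetric] by (simp add: algebra_simps)
    then have "D * exp (- real n * u) = (D * exp (- real n * (u - v))) * exp (- real n * v)"
      by (simp only: mult.assoc)
    also have "\<dots> \<le> 1 * exp (- real n * v)" using elim by (intro mult_right_mono) auto
    finally show ?case by simp
  qed
qed

section \<open>From exponential bounds to iterated logarithmic limits\<close>

lemma Limsup_elog_le:
  fixes p :: "nat \<Rightarrow> real \<Rightarrow> real"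
  assumes nonneg: "\<And>n t. 0 \<le> p n t"
    and bound: "\<And>\<epsilon>. 0 < \<epsilon> \<Longrightarrow> \<forall>\<^sub>F t in at_top. \<forall>\<^sub>F n in sequentially. p n t \<le> exp (- real n * (t * (C - \<epsilon>)))"
  shows "Limsup at_top (\<lambda>t. limsup (\<lambda>n. ereal (1 / t) * ereal (1 / real n) * elog (p n t))) \<le> ereal (- C)"
proof (rule ereal_le_epsilon2)
  fix \<epsilon> :: real assume "0 < \<epsilon>"
  from bound[OF this] eventually_gt_at_top[of "0::real"]
  have "\<forall>\<^sub>F t in at_top. limsup (\<lambda>n. ereal (1 / t) * ereal (1 / real n) * elog (p n t)) \<le> ereal (- C + \<epsilon>)"
  proof eventually_elim
    case (elim t)
    from elim(1) eventually_gt_at_top[of "0::nat"]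
    have "\<forall>\<^sub>F n in sequentially. ereal (1 / t) * ereal (1 / real n) * elog (p n t) \<le> ereal (- C + \<epsilon>)"
    proof eventually_elim
      case (elim n)
      show ?case
      proof (cases "p n t = 0")
        case True
        then show ?thesis using elim \<open>0 < t\<close> by (simp add: elog_def)
      next
        case False
        then have "0 < p n t" using nonneg[of n t] by simp
        then have "ln (p n t) \<le> - real n * (t * (C - \<epsilon>))"
          using elim(1) by (metis exp_gt_zero ln_exp ln_le_cancel_iff)
        then have "ln (p n t) / (t * real n) \<le> (- real n * (t * (C - \<epsilon>))) / (t * real n)"
          using \<open>0 < t\<close> elim(2) by (intro divide_right_mono) auto
        also have "\<dots> = - C + \<epsilon>" using \<open>0 < t\<close> elim(2) by (simp add: field_simps)
        finally show ?thesis using False by (simp add: elog_def)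
      qed
    qed
    then show ?case by (rule Limsup_bounded)
  qed
  then have "Limsup at_top (\<lambda>t. limsup (\<lambda>n. ereal (1 / t) * ereal (1 / real n) * elog (p n t))) \<le> ereal (- C + \<epsilon>)"
    by (rule Limsup_bounded)
  then show "Limsup at_top (\<lambda>t. limsup (\<lambda>n. ereal (1 / t) * ereal (1 / real n) * elog (p n t))) \<le> ereal (- C) + ereal \<epsilon>"
    by simp
qed

lemma Liminf_elog_ge:
  fixes p :: "nat \<Rightarrow> real \<Rightarrow> real"
  assumes bound: "\<And>\<epsilon>. 0 < \<epsilon> \<Longrightarrow> \<forall>\<^sub>F t in at_top. \<forall>\<^sub>F n in sequentially. exp (- real n * (t * (C + \<epsilon>))) \<le> p n t"
  shows "ereal (- C) \<le> Liminf at_top (\<lambda>t. liminf (\<lambda>n. ereal (1 / t) * ereal (1 / real n) * elog (p n t)))"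
proof (rule ereal_le_epsilon2)
  fix \<epsilon> :: real assume "0 < \<epsilon>"
  from bound[OF this] eventually_gt_at_top[of "0::real"]
  have "\<forall>\<^sub>F t in at_top. ereal (- C - \<epsilon>) \<le> liminf (\<lambda>n. ereal (1 / t) * ereal (1 / real n) * elog (p n t))"
  proof eventually_elim
    case (elim t)
    from elim(1) eventually_gt_at_top[of "0::nat"]
    have "\<forall>\<^sub>F n in sequentially. ereal (- C - \<epsilon>) \<le> ereal (1 / t) * ereal (1 / real n) * elog (p n t)"
    proof eventually_elim
      case (elim n)
      have p: "0 < p n t" using elim(1) less_le_trans[OF exp_gt_zero] by blast
      then have "- real n * (t * (C + \<epsilon>)) \<le> ln (p n t)"
        using elim(1) by (metis exp_gt_zero ln_exp ln_le_cancel_iff)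
      then have "(- real n * (t * (C + \<epsilon>))) / (t * real n) \<le> ln (p n t) / (t * real n)"
        using \<open>0 < t\<close> elim(2) by (intro divide_right_mono) auto
      moreover have "(- real n * (t * (C + \<epsilon>))) / (t * real n) = - C - \<epsilon>"
        using \<open>0 < t\<close> elim(2) by (simp add: field_simps)
      ultimately show ?case using p by (simp add: elog_def)
    qed
    then show ?case by (rule Liminf_bounded)
  qed
  then have "ereal (- C - \<epsilon>) \<le> Liminf at_top (\<lambda>t. liminf (\<lambda>n. ereal (1 / t) * ereal (1 / real n) * elog (p n t)))"
    by (rule Liminf_bounded)
  then have "ereal (- C - \<epsilon>) + ereal \<epsilon> \<le>
      Liminf at_top (\<lambda>t. liminf (\<lambda>n. ereal (1 / t) * ereal (1 / real n) * elog (p n t))) + ereal \<epsilon>"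
    by (rule add_right_mono)
  then show "ereal (- C) \<le> Liminf at_top (\<lambda>t. liminf (\<lambda>n. ereal (1 / t) * ereal (1 / real n) * elog (p n t))) + ereal \<epsilon>"
    by simp
qed

text \<open>Used with the strict event inside the non-strict one. It closes a cycle of inequalities,
  so that an upper estimate for one limit and a lower estimate for the other give both
  equalities.\<close>

lemma Liminf_elog_le_Limsup:
  fixes p q :: "nat \<Rightarrow> real \<Rightarrow> real"
  assumes "\<And>n t. 0 < n \<Longrightarrow> 0 < t \<Longrightarrow> q n t \<le> p n t" "\<And>n t. 0 \<le> q n t"
  shows "Liminf at_top (\<lambda>t. liminf (\<lambda>n. ereal (1 / t) * ereal (1 / real n) * elog (q n t)))
    \<le> Limsup at_top (\<lambda>t. limsup (\<lambda>n. ereal (1 / t) * ereal (1 / real n) * elog (p n t)))"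
proof -
  let ?f = "\<lambda>p t n. ereal (1 / t) * ereal (1 / real n) * elog (p n t)"
  have "Liminf at_top (\<lambda>t. liminf (?f q t)) \<le> Limsup at_top (\<lambda>t. liminf (?f q t))"
    by (rule Liminf_le_Limsup) simp
  also have "\<dots> \<le> Limsup at_top (\<lambda>t. limsup (?f p t))"
  proof (rule Limsup_mono)
    show "\<forall>\<^sub>F t in at_top. liminf (?f q t) \<le> limsup (?f p t)"
      using eventually_gt_at_top[of "0::real"]
    proof eventually_elim
      case (elim t)
      have "liminf (?f q t) \<le> limsup (?f q t)" by (rule Liminf_le_Limsup) simp
      also have "\<dots> \<le> limsup (?f p t)"
      proof (rule Limsup_mono)
        show "\<forall>\<^sub>F n in sequentially. ?f q t n \<le> ?f p t n"
          using eventually_gt_at_top[of "0::nat"]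
        proof eventually_elim
          case (elim n)
          have "elog (q n t) \<le> elog (p n t)"
            using assms(1)[OF elim \<open>0 < t\<close>] assms(2)[of n t] by (auto simp: elog_def)
          moreover have "0 \<le> ereal (1 / t) * ereal (1 / real n)" using \<open>0 < t\<close> by simp
          ultimately show ?case by (rule ereal_mult_left_mono)
        qed
      qed
      finally show ?case .
    qed
  qed
  finally show ?thesis .
qed

section \<open>The sequence of systems\<close>

lemma eventually_ge_real_nat: "\<forall>\<^sub>F n in sequentially. c \<le> real n"
  using eventually_ge_at_top[of "nat \<lceil>c\<rceil>"] by eventually_elim linarith

locale mm1m_sequence =
  fixes lam mu theta x0 :: real
    and x :: "nat \<Rightarrow> real"
    and P :: "nat \<Rightarrow> 'w measure"
    and N1 N2 :: "nat \<Rightarrow> 'w \<Rightarrow> real measure"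
    and N3 :: "nat \<Rightarrow> 'w \<Rightarrow> (real \<times> real) measure"
    and X R :: "nat \<Rightarrow> real \<Rightarrow> 'w \<Rightarrow> real"
  assumes lam_pos: "0 < lam" and mu_pos: "0 < mu" and theta_pos: "0 < theta"
    and x0_nonneg: "0 \<le> x0" and x_lim: "x \<longlonglongrightarrow> x0"
    and system: "\<And>n. 0 < n \<Longrightarrow> mm1m (P n) lam mu theta n (x n) (N1 n) (N2 n) (N3 n) (X n) (R n)"
begin

lemma eventually_x_le: "\<forall>\<^sub>F n in sequentially. x n \<le> x0 + 1"
  using order_tendstoD(2)[OF x_lim, of "x0 + 1"] by (auto elim: eventually_mono)

abbreviation "netput_plus n \<equiv> mm1m.netput_plus n (N1 n) (N2 n)"

text \<open>The mesh \<open>m\<close> may depend on \<open>t\<close>, \<epsilon> and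
  \<open>K\<close>, but not on \<open>n\<close>. The error \<epsilon> is split evenly between
  reneging below \<open>2 * \<kappa>\<close> and the accumulated quadratic terms.\<close>

lemma eventually_grid_bound:
  assumes t: "0 < t" and \<epsilon>: "0 < \<epsilon>" and K: "0 \<le> K"
  obtains m C where "0 < m"
    "\<forall>\<^sub>F n in sequentially. measure (P n) {\<omega>\<in>space (P n). x n + netput_plus n \<omega> t m + \<epsilon> < R n t \<omega>}
      \<le> C * exp (- real n * K)"
proof -
  \<comment> \<open>\<open>\<beta>' * (\<epsilon> / 2) = 2 * (K + 1)\<close>, and \<kappa> is chosen
    so that \<open>theta * t * (2 * \<kappa>) * exp \<beta>' = K + 1\<close>. The difference leaves
    the rate \<open>K\<close>.\<close>
  define \<beta>' where "\<beta>' = 2 * (K + 1) / (\<epsilon> / 2)"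
  define \<kappa> where "\<kappa> = (K + 1) / (theta * t * 2 * exp \<beta>')"
  define QA where "QA = lam * t * (exp 1 - 1) + K"
  define QB where "QB = mu * t * (exp 1 - 1) + K"
  define M where "M = x0 + 1 + QA"
  define QG where "QG = theta * t * M * (exp 1 - 1) + K"
  define Q where "Q = QA + QB + QG"
  \<comment> \<open>The second entry of the minimum gives
    \<open>6 * \<delta> / \<kappa> * Q \<le> \<epsilon> / 2\<close>.\<close>
  define \<delta> where "\<delta> = min \<kappa> (\<epsilon> / 2 * \<kappa> / (6 * (Q + 1)))"
  define \<beta> where "\<beta> = 2 * (K + 1) / \<delta>"
  define L where "L = max lam (max mu (theta * M))"
  have \<beta>': "0 < \<beta>'" using K \<epsilon> by (simp add: \<beta>'_def)
  have \<kappa>: "0 < \<kappa>" using K theta_pos t by (simp add: \<kappa>_def)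
  have Qs: "0 \<le> QA" "0 \<le> QB" using lam_pos mu_pos t K by (auto simp: QA_def QB_def)
  have M: "0 \<le> M" using x0_nonneg Qs by (simp add: M_def)
  have QG: "0 \<le> QG" using theta_pos t K M by (auto simp: QG_def)
  have Q: "0 \<le> Q" using Qs QG by (simp add: Q_def)
  have \<delta>: "0 < \<delta>" "\<delta> \<le> \<kappa>" using \<kappa> \<epsilon> Q by (auto simp: \<delta>_def)
  have \<delta>Q: "6 * \<delta> / \<kappa> * Q \<le> \<epsilon> / 2"
  proof -
    have "\<delta> * (6 * (Q + 1)) \<le> \<epsilon> / 2 * \<kappa>"
      using Q by (subst pos_le_divide_eq[symmetric]) (auto simp: \<delta>_def)
    then have "6 * \<delta> * Q \<le> \<epsilon> / 2 * \<kappa>" using \<delta> by (simp add: algebra_simps)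
    then show ?thesis using \<kappa> by (simp add: field_simps)
  qed
  have \<beta>: "0 < \<beta>" "\<beta> * \<delta> = 2 * (K + 1)" using K \<delta> by (auto simp: \<beta>_def)
  have L: "0 < L" using lam_pos by (simp add: L_def)
  \<comment> \<open>Every cell mean is at most \<open>L * t / m\<close>. Weighted by
    \<open>exp \<beta>\<close> it must stay below \<open>K + 1\<close>, half of
    \<open>\<beta> * \<delta>\<close>.\<close>
  obtain m :: nat where m: "L * t * exp \<beta> / (K + 1) < real m" using reals_Archimedean2 by blast
  have m0: "0 < real m" using m L t K by (smt (verit) divide_nonneg_nonneg exp_ge_zero mult_nonneg_nonneg)
  have cell: "r * (t / real m) * (exp \<beta> - 1) + K \<le> \<beta> * \<delta>" if "0 \<le> r" "r \<le> L" for r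
  proof -
    have "r * (t / real m) * (exp \<beta> - 1) \<le> L * (t / real m) * exp \<beta>"
      using that t m0 \<beta> L by (intro mult_mono) auto
    also have "\<dots> \<le> K + 1" using m m0 K by (simp add: field_simps)
    finally show ?thesis using \<beta> K by simp
  qed
  have \<eta>: "theta * t * (2 * \<kappa>) * (exp \<beta>' - 1) + K \<le> \<beta>' * (\<epsilon> / 2)"
  proof -
    have "theta * t * (2 * \<kappa>) * (exp \<beta>' - 1) \<le> theta * t * (2 * \<kappa>) * exp \<beta>'"
      using theta_pos t \<kappa> by (intro mult_left_mono) auto
    also have "\<dots> = K + 1" using theta_pos t by (simp add: \<kappa>_def)
    finally show ?thesis using \<epsilon> K by (simp add: \<beta>'_def)
  qed
  have "\<forall>\<^sub>F n in sequentially. measure (P n) {\<omega>\<in>space (P n). x n + netput_plus n \<omega> t m + \<epsilon> < R n t \<omega>}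
      \<le> (4 + 3 * real m) * exp (- real n * K)"
    using eventually_x_le eventually_gt_at_top[of 0]
  proof eventually_elim
    case (elim n)
    interpret s: mm1m "P n" lam mu theta n "x n" "N1 n" "N2 n" "N3 n" "X n" "R n"
      by (rule system) (use elim in simp)
    have "measure (P n) {\<omega>\<in>space (P n). x n + s.netput_plus \<omega> t m + \<epsilon> < R n t \<omega>} \<le>
       measure (P n) {\<omega>\<in>space (P n). x n + s.netput_plus \<omega> t m + \<epsilon> / 2 + 6 * \<delta> / \<kappa> * (QA + QB + QG) < R n t \<omega>}"
      using \<delta>Q s.R_measurable[OF less_imp_le[OF t]] s.measurable_netput_plus[OF less_imp_le[OF t], of m] t
      by (intro s.finite_measure_mono) (auto simp: Q_def)
    also have "\<dots> \<le> (4 + 3 * real m) * exp (- real n * K)"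
    proof (rule s.grid_bound_prob[where M=M and \<beta>=\<beta> and \<beta>'=\<beta>'])
      show "0 < m" using m0 by simp
      show "x n + QA \<le> M" using elim by (simp add: M_def)
      show "lam * (t / real m) * (exp \<beta> - 1) + K \<le> \<beta> * \<delta>" "mu * (t / real m) * (exp \<beta> - 1) + K \<le> \<beta> * \<delta>"
        using lam_pos mu_pos by (intro cell; simp add: L_def)+
      have "theta * M * (t / real m) * (exp \<beta> - 1) + K \<le> \<beta> * \<delta>"
        using theta_pos M by (intro cell) (auto simp: L_def)
      then show "theta * (t / real m) * M * (exp \<beta> - 1) + K \<le> \<beta> * \<delta>" by (simp add: mult_ac)
    qed (use t \<delta> Qs \<eta> \<beta> \<beta>' in \<open>auto simp: QA_def QB_def QG_def\<close>)
    finally show ?case .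
  qed
  then show ?thesis using that m0 by simp
qed

text \<open>A queue of order \<open>t\<close> reneges at a rate of order \<open>t\<close>, so a
  window of constant length \<open>c\<close> suffices to exceed \<open>\<gamma> * t\<close>, while
  arrivals of order \<open>t\<close> within it are rare at any prescribed rate once \<open>t\<close>
  is large.\<close>

lemma eventually_window_bound:
  assumes \<epsilon>: "0 < \<epsilon>" and K: "0 < K" and \<gamma>: "0 \<le> \<gamma>"
  shows "\<forall>\<^sub>F t in at_top. \<forall>\<^sub>F n in sequentially.
    measure (P n) {\<omega>\<in>space (P n). \<epsilon> * t \<le> X n t \<omega> \<and> R n t \<omega> \<le> \<gamma> * t} \<le> 2 * exp (- real n * (t * K))"
proof -
  \<comment> \<open>\<open>\<rho> * t\<close> is the exponent that \<open>PRM_lower_tail\<close>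
    gives per unit of window length for marks up to \<open>\<epsilon> * t / 4\<close>, and
    \<open>c\<close> raises it to \<open>(\<gamma> + K) * t\<close>. The tilt \<beta> makes the
    arrival threshold worth \<open>2 * t * K\<close>, half of which pays for the mean.\<close>
  define \<rho> where "\<rho> = theta * (\<epsilon> / 4) * (1 - exp (- 1))"
  define c where "c = (\<gamma> + K) / \<rho>"
  define \<beta> where "\<beta> = 4 * K / \<epsilon>"
  have "exp (- 1) < (1 :: real)" by simp
  then have \<rho>: "0 < \<rho>" using theta_pos \<epsilon> by (simp add: \<rho>_def)
  have c: "0 \<le> c" "c * \<rho> = \<gamma> + K" using \<rho> \<gamma> K by (auto simp: c_def)
  show ?thesis
    using eventually_ge_at_top[of c] eventually_ge_at_top[of "lam * c * (exp \<beta> - 1) / K"] eventually_gt_at_top[of 0]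
  proof eventually_elim
    case (elim t)
    have "\<forall>\<^sub>F n in sequentially. 4 / real n \<le> \<epsilon> * t"
      using \<epsilon> elim by real_asymp
    with eventually_gt_at_top[of 0] show ?case
    proof eventually_elim
      case (elim n)
      interpret s: mm1m "P n" lam mu theta n "x n" "N1 n" "N2 n" "N3 n" "X n" "R n"
        by (rule system) (use elim in simp)
      show ?case
      proof (rule s.window_prob[where c=c and \<beta>=\<beta>])
        have "lam * c * (exp \<beta> - 1) \<le> t * K" using \<open>_ / K \<le> t\<close> K by (simp add: pos_divide_le_eq)
        moreover have "\<beta> * (\<epsilon> * t / 2) = 2 * (t * K)" using \<epsilon> by (simp add: \<beta>_def)
        ultimately show "lam * c * (exp \<beta> - 1) + t * K \<le> \<beta> * (\<epsilon> * t / 2)" by linarith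
        have eq: "theta * c * (\<epsilon> * t / 4) * (1 - exp (- 1)) = (c * \<rho>) * t" by (simp add: \<rho>_def)
        show "\<gamma> * t + t * K \<le> theta * c * (\<epsilon> * t / 4) * (1 - exp (- 1))"
          unfolding eq c(2) by (simp add: algebra_simps)
      qed (use elim c \<open>c \<le> t\<close> \<epsilon> K in \<open>auto simp: \<beta>_def\<close>)
    qed
  qed
qed

text \<open>Every cell, not only the total, is pinned near its mean under the tilted rates, so that
  the positive parts of the cell netputs add up to little more than the total netput. The
  \<open>m\<close> cells of length \<open>h\<close>, with slack \<open>h * \<epsilon> / 2\<close>
  for each measure, multiply up to the exponent for \<open>t\<close>.\<close>

lemma eventually_grid_counts:
  fixes \<gamma> :: real
  defines "\<alpha> \<equiv> lam / z_root lam mu \<gamma>" and "\<beta> \<equiv> mu * z_root lam mu \<gamma>"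
  assumes t: "0 < t" and m: "0 < m" and \<epsilon>: "0 < \<epsilon>"
  shows "\<forall>\<^sub>F n in sequentially. exp (- real n * (t * (decay_rate lam mu \<gamma> + \<epsilon>))) \<le>
    measure (P n) {\<omega>\<in>space (P n). \<forall>i<m.
      emeasure (N1 n \<omega>) {grid t m i<..grid t m (Suc i)} = of_nat (nat \<lfloor>real n * (\<alpha> * t / real m)\<rfloor>) \<and>
      emeasure (N2 n \<omega>) {grid t m i<..grid t m (Suc i)} = of_nat (nat \<lfloor>real n * (\<beta> * t / real m)\<rfloor>)}"
proof -
  define h where "h = t / real m"
  have h: "0 < h" "real m * h = t" using t m by (auto simp: h_def)
  have z: "0 < z_root lam mu \<gamma>" by (rule z_root_pos[OF lam_pos mu_pos])
  have ab: "0 < \<alpha>" "0 < \<beta>" using z lam_pos mu_pos by (auto simp: \<alpha>_def \<beta>_def)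
  define eA where "eA = lam - \<alpha> + \<alpha> * ln (\<alpha> / lam)"
  define eB where "eB = mu - \<beta> + \<beta> * ln (\<beta> / mu)"
  have e: "eA + eB = decay_rate lam mu \<gamma>"
    using decay_rate_entropy[OF lam_pos mu_pos, of \<gamma>] by (simp add: eA_def eB_def \<alpha>_def \<beta>_def)
  have ratio: "(\<alpha> * t / real m) / (lam * t / real m) = \<alpha> / lam" "(\<beta> * t / real m) / (mu * t / real m) = \<beta> / mu"
    using t m by auto
  have "\<forall>\<^sub>F n in sequentially. exp (- real n * (lam * t / real m - \<alpha> * t / real m +
      \<alpha> * t / real m * ln ((\<alpha> * t / real m) / (lam * t / real m)) + h * (\<epsilon> / 2))) \<le>
    (real n * (lam * t / real m)) ^ nat \<lfloor>real n * (\<alpha> * t / real m)\<rfloor> / fact (nat \<lfloor>real n * (\<alpha> * t / real m)\<rfloor>) *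
      exp (- (real n * (lam * t / real m)))"
    using lam_pos t m ab h \<epsilon> by (intro poisson_point_lower_bound) auto
  moreover have "\<forall>\<^sub>F n in sequentially. exp (- real n * (mu * t / real m - \<beta> * t / real m +
      \<beta> * t / real m * ln ((\<beta> * t / real m) / (mu * t / real m)) + h * (\<epsilon> / 2))) \<le>
    (real n * (mu * t / real m)) ^ nat \<lfloor>real n * (\<beta> * t / real m)\<rfloor> / fact (nat \<lfloor>real n * (\<beta> * t / real m)\<rfloor>) *
      exp (- (real n * (mu * t / real m)))"
    using mu_pos t m ab h \<epsilon> by (intro poisson_point_lower_bound) auto
  ultimately show ?thesis
    using eventually_gt_at_top[of 0]
  proof eventually_elim
    case (elim n)
    interpret s: mm1m "P n" lam mu theta n "x n" "N1 n" "N2 n" "N3 n" "X n" "R n"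
      by (rule system) (use elim in simp)
    let ?pA = "(real n * (lam * t / real m)) ^ nat \<lfloor>real n * (\<alpha> * t / real m)\<rfloor> / fact (nat \<lfloor>real n * (\<alpha> * t / real m)\<rfloor>) *
      exp (- (real n * (lam * t / real m)))"
    let ?pB = "(real n * (mu * t / real m)) ^ nat \<lfloor>real n * (\<beta> * t / real m)\<rfloor> / fact (nat \<lfloor>real n * (\<beta> * t / real m)\<rfloor>) *
      exp (- (real n * (mu * t / real m)))"
    have A: "exp (- real n * (h * (eA + \<epsilon> / 2))) \<le> ?pA"
      using elim(1) unfolding ratio by (simp add: eA_def h_def algebra_simps)
    have B: "exp (- real n * (h * (eB + \<epsilon> / 2))) \<le> ?pB"
      using elim(2) unfolding ratio by (simp add: eB_def h_def algebra_simps)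
    have "- real n * (t * (decay_rate lam mu \<gamma> + \<epsilon>)) =
        real m * (- real n * (h * (eA + \<epsilon> / 2))) + real m * (- real n * (h * (eB + \<epsilon> / 2)))"
      unfolding e[symmetric] h(2)[symmetric] by (simp add: algebra_simps)
    then have "exp (- real n * (t * (decay_rate lam mu \<gamma> + \<epsilon>))) =
        exp (- real n * (h * (eA + \<epsilon> / 2))) ^ m * exp (- real n * (h * (eB + \<epsilon> / 2))) ^ m"
      by (simp only: exp_add exp_of_nat_mult)
    also have "\<dots> \<le> ?pA ^ m * ?pB ^ m"
      using A B order_trans[OF exp_ge_zero A]
      by (intro mult_mono power_mono zero_le_power exp_ge_zero)
    finally show ?case unfolding s.grid_counts_prob[OF t m] .
  qed
qed

section \<open>Upper estimates\<close>

lemma upper_bound_above: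
  assumes le: "mu \<le> lam" and \<gamma>: "lam - mu < \<gamma>" and \<epsilon>: "0 < \<epsilon>"
  shows "\<forall>\<^sub>F t in at_top. \<forall>\<^sub>F n in sequentially.
    measure (P n) {\<omega>\<in>space (P n). R n t \<omega> \<ge> \<gamma> * t} \<le> exp (- real n * (t * (decay_rate lam mu \<gamma> - \<epsilon>)))"
proof -
  define z where "z = z_root lam mu \<gamma>"
  define \<alpha> where "\<alpha> = - ln z"
  define C where "C = decay_rate lam mu \<gamma>"
  \<comment> \<open>Lowering the threshold by \<open>2 * e\<close> costs
    \<open>2 * \<alpha> * e = \<epsilon> / 2\<close> of the rate: one \<open>e\<close> covers the
    initial queue once \<open>x0 + 1 \<le> e * t\<close>, the other the grid error.\<close>
  define e where "e = \<epsilon> / (4 * \<alpha>)"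
  have z: "0 < z" "z < 1"
    using z_root_pos[OF lam_pos mu_pos] z_root_less_1[OF lam_pos mu_pos \<gamma>] by (auto simp: z_def)
  then have \<alpha>: "0 < \<alpha>" by (simp add: \<alpha>_def)
  have e: "0 < e" "\<alpha> * e = \<epsilon> / 4" using \<alpha> \<epsilon> by (auto simp: e_def)
  have C: "C = \<alpha> * \<gamma> - log_mgf lam mu \<alpha>"
    using decay_rate_legendre[OF lam_pos mu_pos, of \<gamma>] by (simp add: C_def \<alpha>_def z_def)
  have H: "0 \<le> log_mgf lam mu \<alpha>" using le mu_pos \<alpha> by (intro log_mgf_nonneg) auto
  show ?thesis
    using eventually_gt_at_top[of 0] eventually_ge_at_top[of "(x0 + 1) / e"]
  proof eventually_elim
    case (elim t)
    then have t: "0 < t" and x0t: "x0 + 1 \<le> e * t" using e by (auto simp: pos_divide_le_eq mult.commute)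
    \<comment> \<open>The absolute value keeps the prescribed rate nonnegative and at least
      \<open>t * C\<close>.\<close>
    obtain m D where m: "0 < m" and D: "\<forall>\<^sub>F n in sequentially.
        measure (P n) {\<omega>\<in>space (P n). x n + netput_plus n \<omega> t m + e * t < R n t \<omega>} \<le> D * exp (- real n * (t * \<bar>C\<bar>))"
      using eventually_grid_bound[OF t, of "e * t" "t * \<bar>C\<bar>"] t e by auto
    have "\<forall>\<^sub>F n in sequentially. (\<bar>D\<bar> + 2 ^ m) * exp (- real n * (t * (C - \<epsilon> / 2))) \<le> exp (- real n * (t * (C - \<epsilon>)))"
      using t \<epsilon> by (intro eventually_exp_absorb mult_strict_left_mono) auto
    with D eventually_x_le eventually_gt_at_top[of 0] show ?case
    proof eventually_elim
      case (elim n)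
      interpret s: mm1m "P n" lam mu theta n "x n" "N1 n" "N2 n" "N3 n" "X n" "R n"
        by (rule system) (use elim in simp)
      note [measurable] = s.R_measurable[OF less_imp_le[OF t]] s.measurable_netput_plus[OF less_imp_le[OF t], of m]
      let ?bad = "{\<omega>\<in>space (P n). x n + s.netput_plus \<omega> t m + e * t < R n t \<omega>}"
      let ?net = "{\<omega>\<in>space (P n). (\<gamma> - 2 * e) * t \<le> s.netput_plus \<omega> t m}"
      have sets: "?bad \<in> s.events" "?net \<in> s.events" by measurable
      have "measure (P n) {\<omega>\<in>space (P n). R n t \<omega> \<ge> \<gamma> * t} \<le> measure (P n) (?bad \<union> ?net)"
        using sets x0t elim(2) by (intro s.finite_measure_mono sets.Un) (auto simp: algebra_simps)
      also have "\<dots> \<le> measure (P n) ?bad + measure (P n) ?net"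
        using sets by (rule measure_Un_le)
      also have "measure (P n) ?bad \<le> \<bar>D\<bar> * exp (- real n * (t * (C - \<epsilon> / 2)))"
      proof -
        have "t * (C - \<epsilon> / 2) \<le> t * \<bar>C\<bar>" using t \<epsilon> by (intro mult_left_mono) auto
        then have "exp (- real n * (t * \<bar>C\<bar>)) \<le> exp (- real n * (t * (C - \<epsilon> / 2)))"
          by (simp add: mult_left_mono)
        then have "D * exp (- real n * (t * \<bar>C\<bar>)) \<le> \<bar>D\<bar> * exp (- real n * (t * (C - \<epsilon> / 2)))"
          by (intro mult_mono) auto
        then show ?thesis using elim(1) by linarith
      qed
      also have "measure (P n) ?net \<le> 2 ^ m * exp (- real n * (t * (C - \<epsilon> / 2)))"
      proof -
        have "\<alpha> * ((\<gamma> - 2 * e) * t) - t * log_mgf lam mu \<alpha> = t * (\<alpha> * \<gamma> - log_mgf lam mu \<alpha>) - 2 * t * (\<alpha> * e)"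
          by (simp add: algebra_simps)
        also have "\<dots> = t * (C - \<epsilon> / 2)" unfolding e(2) C by (simp add: algebra_simps)
        finally show ?thesis
          using s.netput_plus_tail[OF t m, of \<alpha> "(\<gamma> - 2 * e) * t"] \<alpha> H by (simp add: log_mgf_def)
      qed
      finally show ?case using elim(4) by (simp add: C_def algebra_simps)
    qed
  qed
qed

lemma upper_bound_below:
  assumes \<gamma>: "0 < \<gamma>" "\<gamma> < lam - mu" and \<epsilon>: "0 < \<epsilon>"
  shows "\<forall>\<^sub>F t in at_top. \<forall>\<^sub>F n in sequentially.
    measure (P n) {\<omega>\<in>space (P n). R n t \<omega> \<le> \<gamma> * t} \<le> exp (- real n * (t * (decay_rate lam mu \<gamma> - \<epsilon>)))"
proof -
  define z where "z = z_root lam mu \<gamma>"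
  define \<beta> where "\<beta> = ln z"
  define C where "C = decay_rate lam mu \<gamma>"
  \<comment> \<open>Only the queue left at time \<open>t\<close>, allowed up to
    \<open>e * t\<close>, shifts the threshold; this costs
    \<open>\<beta> * e = \<epsilon> / 2\<close>. The initial queue works in the favourable
    direction.\<close>
  define e where "e = \<epsilon> / (2 * \<beta>)"
  have z: "1 < z" using z_root_greater_1[OF lam_pos mu_pos \<gamma>(2)] by (simp add: z_def)
  then have \<beta>: "0 < \<beta>" by (simp add: \<beta>_def)
  have e: "0 < e" "\<beta> * e = \<epsilon> / 2" using \<beta> \<epsilon> by (auto simp: e_def)
  have C: "C = - \<beta> * \<gamma> - log_mgf lam mu (- \<beta>)"
    using decay_rate_legendre[OF lam_pos mu_pos, of \<gamma>] by (simp add: C_def \<beta>_def z_def)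
  have K: "0 < \<bar>C\<bar> + 1" by simp
  show ?thesis
    using eventually_window_bound[OF e(1) K, of \<gamma>, OF less_imp_le[OF \<gamma>(1)]] eventually_gt_at_top[of 0]
  proof eventually_elim
    case (elim t)
    then have t: "0 < t" by simp
    have "\<forall>\<^sub>F n in sequentially. 3 * exp (- real n * (t * (C - \<epsilon> / 2))) \<le> exp (- real n * (t * (C - \<epsilon>)))"
      using t \<epsilon> by (intro eventually_exp_absorb mult_strict_left_mono) auto
    with elim(1) eventually_gt_at_top[of 0] show ?case
    proof eventually_elim
      case (elim n)
      interpret s: mm1m "P n" lam mu theta n "x n" "N1 n" "N2 n" "N3 n" "X n" "R n"
        by (rule system) (use elim in simp)
      note [measurable] = s.R_measurable[OF less_imp_le[OF t]] s.X_measurable[OF less_imp_le[OF t]]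
      note [measurable] = s.measurable_counts[OF order_refl, of t]
      let ?bad = "{\<omega>\<in>space (P n). e * t \<le> X n t \<omega> \<and> R n t \<omega> \<le> \<gamma> * t}"
      let ?net = "{\<omega>\<in>space (P n). s.a \<omega> 0 t - s.b \<omega> 0 t \<le> (\<gamma> + e) * t}"
      have sets: "?bad \<in> s.events" "?net \<in> s.events" by measurable
      have "measure (P n) {\<omega>\<in>space (P n). R n t \<omega> \<le> \<gamma> * t} \<le> measure (P n) (?bad \<union> ?net)"
      proof (rule s.finite_measure_mono_AE)
        show "AE \<omega> in P n. \<omega> \<in> {\<omega>\<in>space (P n). R n t \<omega> \<le> \<gamma> * t} \<longrightarrow> \<omega> \<in> ?bad \<union> ?net"
          using s.AE_X_plus_R_ge[OF less_imp_le[OF t]]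
          by eventually_elim (use s.x_nonneg in \<open>auto simp: algebra_simps\<close>)
      qed (use sets in auto)
      also have "\<dots> \<le> measure (P n) ?bad + measure (P n) ?net"
        using sets by (rule measure_Un_le)
      also have "measure (P n) ?bad \<le> 2 * exp (- real n * (t * (C - \<epsilon> / 2)))"
      proof -
        have "t * (C - \<epsilon> / 2) \<le> t * (\<bar>C\<bar> + 1)" using t \<epsilon> by (intro mult_left_mono) auto
        then have "exp (- real n * (t * (\<bar>C\<bar> + 1))) \<le> exp (- real n * (t * (C - \<epsilon> / 2)))"
          by (simp add: mult_left_mono)
        then show ?thesis using elim(1) by linarith
      qed
      also have "measure (P n) ?net \<le> exp (- real n * (t * (C - \<epsilon> / 2)))"
      proof -
        have "\<beta> * ((\<gamma> + e) * t) + t * log_mgf lam mu (- \<beta>) = t * (\<beta> * \<gamma> + log_mgf lam mu (- \<beta>)) + t * (\<beta> * e)"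
          by (simp add: algebra_simps)
        also have "\<dots> = - (t * (C - \<epsilon> / 2))" unfolding e(2) C by (simp add: algebra_simps)
        finally have eq: "\<beta> * ((\<gamma> + e) * t) + t * log_mgf lam mu (- \<beta>) = - (t * (C - \<epsilon> / 2))" .
        have "measure (P n) ?net \<le> exp (real n * (\<beta> * ((\<gamma> + e) * t) + t * log_mgf lam mu (- \<beta>)))"
          using s.netput_lower_tail[of t \<beta> "(\<gamma> + e) * t"] t \<beta> by (simp add: log_mgf_def)
        then show ?thesis unfolding eq by simp
      qed
      finally show ?case using elim(3) by (simp add: C_def)
    qed
  qed
qed

section \<open>Lower estimates\<close>

lemma decay_rate_near:
  assumes "0 < \<epsilon>"
  obtains d where "0 < d" "\<And>\<gamma>'. \<bar>\<gamma>' - \<gamma>\<bar> < d \<Longrightarrow> decay_rate lam mu \<gamma>' < decay_rate lam mu \<gamma> + \<epsilon>"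
proof -
  have "isCont (decay_rate lam mu) \<gamma>" by (rule isCont_decay_rate[OF lam_pos mu_pos])
  then obtain d where "0 < d" "\<forall>\<gamma>'. dist \<gamma>' \<gamma> < d \<longrightarrow> dist (decay_rate lam mu \<gamma>') (decay_rate lam mu \<gamma>) < \<epsilon>"
    unfolding continuous_at_eps_delta using assms by blast
  then show ?thesis by (intro that[of d]) (auto simp: dist_real_def)
qed

text \<open>The bad event has a strictly larger rate than the good one, so removing it from the good
  event does not change the exponent. The fractions of \<epsilon> cover the continuity error in
  \<open>C'\<close>, the rate of the good event and the prefactor.\<close>

lemma lower_bound_combine:
  assumes t: "0 < t" and \<epsilon>: "0 < \<epsilon>" and C: "C' \<le> C + \<epsilon> / 4" and K: "C' + \<epsilon> / 2 \<le> K"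
    and good: "\<forall>\<^sub>F n in sequentially. exp (- real n * (t * (C' + \<epsilon> / 4))) \<le> measure (P n) (G n)"
    and bad: "\<forall>\<^sub>F n in sequentially. measure (P n) (B n) \<le> D * exp (- real n * (t * K))"
    and sub: "\<forall>\<^sub>F n in sequentially. measure (P n) (G n) \<le> measure (P n) (T n) + measure (P n) (B n)"
  shows "\<forall>\<^sub>F n in sequentially. exp (- real n * (t * (C + \<epsilon>))) \<le> measure (P n) (T n)"
proof -
  have "\<forall>\<^sub>F n in sequentially. (1 + \<bar>D\<bar>) * exp (- real n * (t * (C' + \<epsilon> / 2))) \<le> exp (- real n * (t * (C' + \<epsilon> / 4)))"
    using t \<epsilon> by (intro eventually_exp_absorb mult_strict_left_mono) auto
  with good bad sub show ?thesis
  proof eventually_elim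
    case (elim n)
    have "t * (C' + \<epsilon> / 2) \<le> t * K" using t K by (intro mult_left_mono) auto
    then have "exp (- real n * (t * K)) \<le> exp (- real n * (t * (C' + \<epsilon> / 2)))"
      by (simp add: mult_left_mono)
    then have "D * exp (- real n * (t * K)) \<le> \<bar>D\<bar> * exp (- real n * (t * (C' + \<epsilon> / 2)))"
      by (intro mult_mono) auto
    then have "exp (- real n * (t * (C' + \<epsilon> / 2))) \<le> measure (P n) (T n)"
      using elim by (simp add: distrib_right)
    moreover have "exp (- real n * (t * (C + \<epsilon>))) \<le> exp (- real n * (t * (C' + \<epsilon> / 2)))"
    proof -
      have "t * (C' + \<epsilon> / 2) \<le> t * (C + \<epsilon>)" using t C \<epsilon> by (intro mult_left_mono) auto
      then show ?thesis by (simp add: mult_left_mono)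
    qed
    ultimately show ?case by linarith
  qed
qed

lemma nat_floor_bounds:
  fixes y :: real
  assumes "0 \<le> y"
  shows "real (nat \<lfloor>y\<rfloor>) \<le> y" "y - 1 \<le> real (nat \<lfloor>y\<rfloor>)"
  using assms by linarith+

lemma lower_bound_above:
  assumes \<gamma>: "0 < \<gamma>" and \<epsilon>: "0 < \<epsilon>"
  shows "\<forall>\<^sub>F t in at_top. \<forall>\<^sub>F n in sequentially.
    exp (- real n * (t * (decay_rate lam mu \<gamma> + \<epsilon>))) \<le> measure (P n) {\<omega>\<in>space (P n). R n t \<omega> > \<gamma> * t}"
proof -
  obtain d where d: "0 < d" "\<And>\<gamma>'. \<bar>\<gamma>' - \<gamma>\<bar> < d \<Longrightarrow> decay_rate lam mu \<gamma>' < decay_rate lam mu \<gamma> + \<epsilon> / 4"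
    using decay_rate_near[of "\<epsilon> / 4" \<gamma>] \<epsilon> by auto
  \<comment> \<open>Aiming at drift \<open>\<gamma> + d / 2\<close> leaves \<open>d / 4\<close> for
    integer rounding and \<open>d / 4\<close> for the queue remaining at time
    \<open>t\<close>.\<close>
  define \<gamma>' where "\<gamma>' = \<gamma> + d / 2"
  define C where "C = decay_rate lam mu \<gamma>"
  define C' where "C' = decay_rate lam mu \<gamma>'"
  define K where "K = \<bar>C'\<bar> + \<epsilon>"
  define z where "z = z_root lam mu \<gamma>'"
  have C': "C' \<le> C + \<epsilon> / 4" using d(1) d(2)[of \<gamma>'] by (simp add: C'_def C_def \<gamma>'_def)
  have K: "0 < K" "C' + \<epsilon> / 2 \<le> K" using \<epsilon> by (auto simp: K_def)
  have z: "0 < z" "lam / z - mu * z = \<gamma>'"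
    using z_root_pos[OF lam_pos mu_pos] z_root_difference[OF lam_pos mu_pos] by (auto simp: z_def)
  show ?thesis
    using eventually_window_bound[of "d / 4" K \<gamma>, OF _ K(1)] eventually_gt_at_top[of 0]
  proof (rule eventually_elim2)
    show "0 < d / 4" "0 \<le> \<gamma>" using d \<gamma> by auto
    fix t :: real assume bad: "\<forall>\<^sub>F n in sequentially.
      measure (P n) {\<omega>\<in>space (P n). d / 4 * t \<le> X n t \<omega> \<and> R n t \<omega> \<le> \<gamma> * t} \<le> 2 * exp (- real n * (t * K))"
      and t: "0 < t"
    \<comment> \<open>A single cell suffices, because \<open>X + R\<close> dominates the netput over
      all of \<open>(0, t]\<close>; \<open>real 1\<close> is the mesh in
      \<open>eventually_grid_counts\<close>.\<close>
    define j where "j n = nat \<lfloor>real n * (lam / z * t / real 1)\<rfloor>" for n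
    define l where "l n = nat \<lfloor>real n * (mu * z * t / real 1)\<rfloor>" for n
    define G where "G n = {\<omega>\<in>space (P n). \<forall>i<1::nat.
      emeasure (N1 n \<omega>) {grid t 1 i<..grid t 1 (Suc i)} = of_nat (j n) \<and>
      emeasure (N2 n \<omega>) {grid t 1 i<..grid t 1 (Suc i)} = of_nat (l n)}" for n
    have good: "\<forall>\<^sub>F n in sequentially. exp (- real n * (t * (C' + \<epsilon> / 4))) \<le> measure (P n) (G n)"
      unfolding G_def j_def l_def C'_def z_def using t \<epsilon> by (intro eventually_grid_counts) auto
    have "\<forall>\<^sub>F n in sequentially. 4 / (d * t) \<le> real n" by (rule eventually_ge_real_nat)
    then have sub: "\<forall>\<^sub>F n in sequentially. measure (P n) (G n) \<le> measure (P n) {\<omega>\<in>space (P n). R n t \<omega> > \<gamma> * t} +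
        measure (P n) {\<omega>\<in>space (P n). d / 4 * t \<le> X n t \<omega> \<and> R n t \<omega> \<le> \<gamma> * t}"
      using eventually_gt_at_top[of 0]
    proof eventually_elim
      case (elim n)
      interpret s: mm1m "P n" lam mu theta n "x n" "N1 n" "N2 n" "N3 n" "X n" "R n"
        by (rule system) (use elim in simp)
      note [measurable] = s.R_measurable[OF less_imp_le[OF t]] s.X_measurable[OF less_imp_le[OF t]]
      let ?T = "{\<omega>\<in>space (P n). R n t \<omega> > \<gamma> * t}"
      let ?B = "{\<omega>\<in>space (P n). d / 4 * t \<le> X n t \<omega> \<and> R n t \<omega> \<le> \<gamma> * t}"
      have sets: "?T \<in> s.events" "?B \<in> s.events" by measurable
      have n: "0 < real n" "1 / real n \<le> d / 4 * t"
        using elim d t by (auto simp: field_simps)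
      have "real n * (lam / z * t) - 1 \<le> real (j n)" "real (l n) \<le> real n * (mu * z * t)"
        using lam_pos mu_pos z t unfolding j_def l_def by (auto intro!: nat_floor_bounds)
      then have "real n * (lam / z * t) - 1 - real n * (mu * z * t) \<le> real (j n) - real (l n)" by linarith
      moreover have "real n * (lam / z * t) - real n * (mu * z * t) = real n * (\<gamma>' * t)"
        unfolding z(2)[symmetric] by (simp add: algebra_simps)
      ultimately have "real n * (\<gamma>' * t) - 1 \<le> real (j n) - real (l n)" by linarith
      then have "(real n * (\<gamma>' * t) - 1) / real n \<le> (real (j n) - real (l n)) / real n"
        by (intro divide_right_mono) auto
      then have jl: "\<gamma>' * t - d / 4 * t \<le> real (j n) / real n - real (l n) / real n"
        using n by (simp add: diff_divide_distrib)
      have "measure (P n) (G n) \<le> measure (P n) (?T \<union> ?B)"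
      proof (rule s.finite_measure_mono_AE)
        show "AE \<omega> in P n. \<omega> \<in> G n \<longrightarrow> \<omega> \<in> ?T \<union> ?B"
          using s.AE_X_plus_R_ge[OF less_imp_le[OF t]]
        proof eventually_elim
          case (elim \<omega>)
          show ?case
          proof
            assume \<omega>: "\<omega> \<in> G n"
            then have "s.a \<omega> 0 t = real (j n) / real n" "s.b \<omega> 0 t = real (l n) / real n"
              by (simp_all add: G_def s.a_def s.b_def measure_def)
            then have "\<gamma>' * t - d / 4 * t \<le> X n t \<omega> + R n t \<omega>" using elim s.x_nonneg jl by linarith
            then have "d / 4 * t \<le> X n t \<omega> \<or> \<gamma> * t < R n t \<omega>"
              by (simp add: \<gamma>'_def algebra_simps) linarith
            then show "\<omega> \<in> ?T \<union> ?B" using \<omega> by (auto simp: G_def)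
          qed
        qed
      qed (use sets in auto)
      also have "\<dots> \<le> measure (P n) ?T + measure (P n) ?B" using sets by (rule measure_Un_le)
      finally show ?case .
    qed
    show "\<forall>\<^sub>F n in sequentially. exp (- real n * (t * (decay_rate lam mu \<gamma> + \<epsilon>))) \<le>
        measure (P n) {\<omega>\<in>space (P n). R n t \<omega> > \<gamma> * t}"
      using lower_bound_combine[OF t \<epsilon> C' K(2) good bad sub] by (simp add: C_def)
  qed
qed

lemma lower_bound_below:
  assumes \<gamma>: "0 < \<gamma>" and \<epsilon>: "0 < \<epsilon>"
  shows "\<forall>\<^sub>F t in at_top. \<forall>\<^sub>F n in sequentially.
    exp (- real n * (t * (decay_rate lam mu \<gamma> + \<epsilon>))) \<le> measure (P n) {\<omega>\<in>space (P n). R n t \<omega> < \<gamma> * t}"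
proof -
  obtain d0 where d0: "0 < d0" "\<And>\<gamma>'. \<bar>\<gamma>' - \<gamma>\<bar> < d0 \<Longrightarrow> decay_rate lam mu \<gamma>' < decay_rate lam mu \<gamma> + \<epsilon> / 4"
    using decay_rate_near[of "\<epsilon> / 4" \<gamma>] \<epsilon> by auto
  \<comment> \<open>The cap at \<gamma> keeps \<open>\<gamma>'\<close> positive, so that the upper
    bound on the cell netput is nonnegative and also bounds its positive part.\<close>
  define d where "d = min d0 \<gamma>"
  define \<gamma>' where "\<gamma>' = \<gamma> - d / 2"
  define C where "C = decay_rate lam mu \<gamma>"
  define C' where "C' = decay_rate lam mu \<gamma>'"
  define K where "K = \<bar>C'\<bar> + \<epsilon>"
  define z where "z = z_root lam mu \<gamma>'"
  have d: "0 < d" using d0 \<gamma> by (simp add: d_def)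
  have \<gamma>': "0 < \<gamma>'" using \<gamma> by (simp add: \<gamma>'_def d_def)
  have "\<bar>\<gamma>' - \<gamma>\<bar> < d0" using d0(1) \<gamma> by (auto simp: \<gamma>'_def d_def)
  then have C': "C' \<le> C + \<epsilon> / 4" using d0(2)[of \<gamma>'] by (simp add: C'_def C_def)
  have K: "0 < K" "C' + \<epsilon> / 2 \<le> K" using \<epsilon> by (auto simp: K_def)
  have z: "0 < z" "lam / z - mu * z = \<gamma>'"
    using z_root_pos[OF lam_pos mu_pos] z_root_difference[OF lam_pos mu_pos] by (auto simp: z_def)
  \<comment> \<open>The margin \<open>\<gamma> - \<gamma>'\<close> equals \<open>4 * e\<close>: one
    \<open>e\<close> each for the initial queue, the rounding over \<open>m\<close> cells and the
    grid error, and one to make the inequality strict.\<close>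
  define e where "e = d / 8"
  have e: "0 < e" using d by (simp add: e_def)
  show ?thesis
    using eventually_gt_at_top[of 0] eventually_ge_at_top[of "(x0 + 1) / e"]
  proof eventually_elim
    case (elim t)
    then have t: "0 < t" and x0t: "x0 + 1 \<le> e * t" using e by (auto simp: pos_divide_le_eq mult.commute)
    obtain m D where m: "0 < m" and bad: "\<forall>\<^sub>F n in sequentially.
        measure (P n) {\<omega>\<in>space (P n). x n + netput_plus n \<omega> t m + e * t < R n t \<omega>} \<le> D * exp (- real n * (t * K))"
      using eventually_grid_bound[OF t, of "e * t" "t * K"] t e K by auto
    define j where "j n = nat \<lfloor>real n * (lam / z * t / real m)\<rfloor>" for n
    define l where "l n = nat \<lfloor>real n * (mu * z * t / real m)\<rfloor>" for n
    define G where "G n = {\<omega>\<in>space (P n). \<forall>i<m.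
      emeasure (N1 n \<omega>) {grid t m i<..grid t m (Suc i)} = of_nat (j n) \<and>
      emeasure (N2 n \<omega>) {grid t m i<..grid t m (Suc i)} = of_nat (l n)}" for n
    have good: "\<forall>\<^sub>F n in sequentially. exp (- real n * (t * (C' + \<epsilon> / 4))) \<le> measure (P n) (G n)"
      unfolding G_def j_def l_def C'_def z_def using t \<epsilon> m by (intro eventually_grid_counts) auto
    have "\<forall>\<^sub>F n in sequentially. real m / (e * t) \<le> real n" by (rule eventually_ge_real_nat)
    then have sub: "\<forall>\<^sub>F n in sequentially. measure (P n) (G n) \<le> measure (P n) {\<omega>\<in>space (P n). R n t \<omega> < \<gamma> * t} +
        measure (P n) {\<omega>\<in>space (P n). x n + netput_plus n \<omega> t m + e * t < R n t \<omega>}"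
      using eventually_gt_at_top[of 0] eventually_x_le
    proof eventually_elim
      case (elim n)
      interpret s: mm1m "P n" lam mu theta n "x n" "N1 n" "N2 n" "N3 n" "X n" "R n"
        by (rule system) (use elim in simp)
      note [measurable] = s.R_measurable[OF less_imp_le[OF t]] s.measurable_netput_plus[OF less_imp_le[OF t], of m]
      let ?T = "{\<omega>\<in>space (P n). R n t \<omega> < \<gamma> * t}"
      let ?B = "{\<omega>\<in>space (P n). x n + s.netput_plus \<omega> t m + e * t < R n t \<omega>}"
      have sets: "?T \<in> s.events" "?B \<in> s.events" by measurable
      have n: "0 < real n" "real m / real n \<le> e * t"
        using elim e t by (auto simp: field_simps)
      have "real (j n) \<le> real n * (lam / z * t / real m)" "real n * (mu * z * t / real m) - 1 \<le> real (l n)"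
        using lam_pos mu_pos z t unfolding j_def l_def by (auto intro!: nat_floor_bounds simp del: times_divide_eq_right)
      then have "real (j n) - real (l n) \<le> real n * (lam / z * t / real m) - real n * (mu * z * t / real m) + 1" by linarith
      also have "real n * (lam / z * t / real m) - real n * (mu * z * t / real m) = real n * (\<gamma>' * (t / real m))"
        unfolding z(2)[symmetric] by (simp add: left_diff_distrib right_diff_distrib diff_divide_distrib)
      finally have "(real (j n) - real (l n)) / real n \<le> (real n * (\<gamma>' * (t / real m)) + 1) / real n"
        by (intro divide_right_mono) auto
      then have jl: "real (j n) / real n - real (l n) / real n \<le> \<gamma>' * (t / real m) + 1 / real n"
        using n by (simp add: diff_divide_distrib add_divide_distrib)
      have "measure (P n) (G n) \<le> measure (P n) (?T \<union> ?B)"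
      proof (rule s.finite_measure_mono)
        show "G n \<subseteq> ?T \<union> ?B"
        proof
          fix \<omega> assume \<omega>: "\<omega> \<in> G n"
          then have "s.a \<omega> (grid t m i) (grid t m (Suc i)) = real (j n) / real n"
            "s.b \<omega> (grid t m i) (grid t m (Suc i)) = real (l n) / real n" if "i < m" for i
            using that by (simp_all add: G_def s.a_def s.b_def measure_def)
          then have "s.netput_plus \<omega> t m = real m * max 0 (real (j n) / real n - real (l n) / real n)"
            by (simp add: s.netput_plus_def)
          also have "\<dots> \<le> real m * (\<gamma>' * (t / real m) + 1 / real n)"
            using jl \<gamma>' t by (intro mult_left_mono) auto
          also have "\<dots> = \<gamma>' * t + real m / real n" using m by (simp add: distrib_left)
          finally have net: "s.netput_plus \<omega> t m \<le> \<gamma>' * t + e * t" using n by linarith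
          have "x n + (\<gamma>' * t + e * t) + e * t < \<gamma> * t"
          proof -
            have "\<gamma> * t = \<gamma>' * t + 4 * (e * t)" by (simp add: \<gamma>'_def e_def algebra_simps)
            moreover have "0 < e * t" using e t by simp
            ultimately show ?thesis using x0t elim(3) by linarith
          qed
          then have "R n t \<omega> < \<gamma> * t \<or> x n + s.netput_plus \<omega> t m + e * t < R n t \<omega>" using net by linarith
          then show "\<omega> \<in> ?T \<union> ?B" using \<omega> by (auto simp: G_def)
        qed
      qed (use sets in auto)
      also have "\<dots> \<le> measure (P n) ?T + measure (P n) ?B" using sets by (rule measure_Un_le)
      finally show ?case .
    qed
    show ?case using lower_bound_combine[OF t \<epsilon> C' K(2) good bad sub] by (simp add: C_def)
  qed
qed

end

theorem mainTheorem4: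
  fixes lam mu theta \<gamma>0 x0 :: real
    and x :: "nat \<Rightarrow> real"
    and P :: "nat \<Rightarrow> 'w measure"
    and N1 N2 :: "nat \<Rightarrow> 'w \<Rightarrow> real measure"
    and N3 :: "nat \<Rightarrow> 'w \<Rightarrow> (real \<times> real) measure"
    and X R :: "nat \<Rightarrow> real \<Rightarrow> 'w \<Rightarrow> real"
  assumes "0 < lam" and "0 < mu" and "0 < theta"
    and "mu \<le> lam"
    and "\<gamma>0 = lam - mu"
    and "0 \<le> x0"
    and "x \<longlonglongrightarrow> x0"
    and "\<And>n. 1 \<le> n \<Longrightarrow>
           mm1m_system (P n) lam mu theta n (x n) (N1 n) (N2 n) (N3 n) (X n) (R n)"
  shows "\<forall>\<gamma>>0. \<gamma> \<noteq> \<gamma>0 \<longrightarrow>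
           chi_plus \<gamma>0 P R \<gamma> = ereal (- decay_rate lam mu \<gamma>) \<and>
           chi_minus \<gamma>0 P R \<gamma> = ereal (- decay_rate lam mu \<gamma>)"
proof (intro allI impI)
  fix \<gamma> :: real assume \<gamma>: "0 < \<gamma>" "\<gamma> \<noteq> \<gamma>0"
  interpret mm1m_sequence lam mu theta x0 x P N1 N2 N3 X R
  proof (rule mm1m_sequence.intro)
    fix n :: nat assume "0 < n"
    then show "mm1m (P n) lam mu theta n (x n) (N1 n) (N2 n) (N3 n) (X n) (R n)"
      using assms(1-3) by (intro mm1m.intro mm1m_axioms.intro assms(8)) simp_all
  qed (fact assms)+
  have mono: "measure (P n) A \<le> measure (P n) B" if "0 < n" "A \<subseteq> B" "B \<in> sets (P n)" for n A B
  proof -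
    interpret s: mm1m "P n" lam mu theta n "x n" "N1 n" "N2 n" "N3 n" "X n" "R n"
      by (rule system) (use that in simp)
    show ?thesis using that by (intro s.finite_measure_mono)
  qed
  have meas: "R n t \<in> borel_measurable (P n)" if "0 < n" "0 < t" for n t
    using mm1m_system.R_measurable[OF assms(8), of n t] that by simp
  show "chi_plus \<gamma>0 P R \<gamma> = ereal (- decay_rate lam mu \<gamma>) \<and> chi_minus \<gamma>0 P R \<gamma> = ereal (- decay_rate lam mu \<gamma>)"
  proof (cases "\<gamma> > \<gamma>0")
    case True
    have "chi_plus \<gamma>0 P R \<gamma> \<le> ereal (- decay_rate lam mu \<gamma>)"
      unfolding chi_plus_def using True assms \<gamma>
      by (simp only: if_True) (intro Limsup_elog_le measure_nonneg upper_bound_above; simp)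
    moreover have "ereal (- decay_rate lam mu \<gamma>) \<le> chi_minus \<gamma>0 P R \<gamma>"
      unfolding chi_minus_def using True assms \<gamma>
      by (simp only: if_True) (intro Liminf_elog_ge lower_bound_above; simp)
    moreover have "chi_minus \<gamma>0 P R \<gamma> \<le> chi_plus \<gamma>0 P R \<gamma>"
      unfolding chi_minus_def chi_plus_def using True
      by (simp only: if_True) (intro Liminf_elog_le_Limsup measure_nonneg mono; use meas in \<open>auto intro: borel_measurable_le\<close>)
    ultimately show ?thesis by auto
  next
    case False
    have "chi_plus \<gamma>0 P R \<gamma> \<le> ereal (- decay_rate lam mu \<gamma>)"
      unfolding chi_plus_def using False assms \<gamma>
      by (simp only: if_False) (intro Limsup_elog_le measure_nonneg upper_bound_below; simp)
    moreover have "ereal (- decay_rate lam mu \<gamma>) \<le> chi_minus \<gamma>0 P R \<gamma>"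
      unfolding chi_minus_def using False assms \<gamma>
      by (simp only: if_False) (intro Liminf_elog_ge lower_bound_below; simp)
    moreover have "chi_minus \<gamma>0 P R \<gamma> \<le> chi_plus \<gamma>0 P R \<gamma>"
      unfolding chi_minus_def chi_plus_def using False
      by (simp only: if_False) (intro Liminf_elog_le_Limsup measure_nonneg mono; use meas in \<open>auto intro: borel_measurable_le\<close>)
    ultimately show ?thesis by auto
  qed
qed

end
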